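(* The configuration $O_6=(\ell_1^+,\ell_1^-,\ell_2^+,\ell_2^-,\ell_3^+,\ell_3^-)\in M^6$ is a point of sharp local maximum (modulo rotations) of the function $\widetilde D$: one has $\widetilde D(O_6)=1$, and there is a neighborhood $W$ of $O_6$ in $M^6$ such that for every $\mathbf m\in W$ which is not of the form $gO_6$ with $g\in SO(3)$, $$\widetilde D(\mathbf m)<1=\widetilde D(O_6).$$
   Context: Let $\mathbb S^2\subset\mathbb R^3$ be the unit sphere centered at the origin. $M$ is the manifold of unoriented straight lines tangent to $\mathbb S^2$; a point of $M$ is represented by a pair $(x,\xi)$ with $x\in\mathbb S^2$ the point of tangency and $\xi$ a unit tangent vector to $\mathbb S^2$ at $x$ giving the direction of the line, with $(x,\xi)$ and $(x,-\xi)$ identified (so $M$ is the quotient of the unit tangent bundle of $\mathbb S^2$ by $\xi\mapsto-\xi$, with the quotient topology and smooth structure). $M^6$ is the manifold of six-tuples of elements of $M$; $SO(3)$ acts on $M^6$ diagonally by rotating all the lines. For two lines $u,v$, $d_{u,v}$ is the Euclidean distance between them. Let $e_1,e_2,e_3$ be the standard basis of $\mathbb R^3$. $\ell_1^{\pm}$ is the line tangent to $\mathbb S^2$ at $\pm e_1$ with direction $e_3$; $\ell_2^{\pm}$ is the line tangent at $\pm e_2$ with direction $e_1$; $\ell_3^{\pm}$ is the line tangent at $\pm e_3$ with direction $e_2$. The configuration $O_6$ is formed by these six lines. For $\mathbf m=(\widetilde\ell_1^+,\widetilde\ell_1^-,\widetilde\ell_2^+,\widetilde\ell_2^-,\widetilde\ell_3^+,\widetilde\ell_3^-)\in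 M^6$ define the minimum of twelve distances $$\widetilde D(\mathbf m)=\min_{1\le i<j\le 3,\ \epsilon,\epsilon'\in\{+,-\}} d_{\widetilde\ell_i^{\epsilon},\widetilde\ell_j^{\epsilon'}} .$$ *)

theory Defs
  imports "HOL-Analysis.Analysis"
begin

definition unit_tangent_bundle :: "((real^3) \<times> (real^3)) set" where
  "unit_tangent_bundle = {(x, \<xi>). norm x = 1 \<and> norm \<xi> = 1 \<and> x \<bullet> \<xi> = 0}"

definition flip_rel :: "(((real^3) \<times> (real^3)) \<times> ((real^3) \<times> (real^3))) set" where
  "flip_rel = {((x, \<xi>), (y, \<eta>)). (x, \<xi>) \<in> unit_tangent_bundle \<and> y = x \<and> (\<eta> = \<xi> \<or> \<eta> = - \<xi>)}"

lemma equiv_flip_rel: "equiv unit_tangent_bundle flip_rel"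
  by (rule equivI)
    (auto simp: refl_on_def sym_on_def trans_on_def flip_rel_def unit_tangent_bundle_def)

text \<open>
  A tangent line is an equivalence class of pairs (point of tangency, unit direction).
\<close>

type_synonym tline = "((real^3) \<times> (real^3)) set"

definition tangent_lines :: "tline set" where
  "tangent_lines = unit_tangent_bundle // flip_rel"

definition tline :: "(real^3) \<times> (real^3) \<Rightarrow> tline" where
  "tline p = flip_rel `` {p}"

definition tline_topology :: "tline topology" where
  "tline_topology = topology (\<lambda>U. U \<subseteq> tangent_lines \<and>
     openin (top_of_set unit_tangent_bundle) {p \<in> unit_tangent_bundle. tline p \<in> U})"

lemma openin_tline_topology:
  "openin tline_topology U \<longleftrightarrow> U \<subseteq> tangent_lines \<and>
     openin (top_of_set unit_tangent_bundle) {p \<in> unit_tangent_bundle. tline p \<in> U}"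
proof -
  have "istopology (\<lambda>U. U \<subseteq> tangent_lines \<and>
     openin (top_of_set unit_tangent_bundle) {p \<in> unit_tangent_bundle. tline p \<in> U})"
    unfolding istopology_def
  proof (intro conjI allI impI)
    fix S T
    assume "S \<subseteq> tangent_lines \<and> openin (top_of_set unit_tangent_bundle) {p \<in> unit_tangent_bundle. tline p \<in> S}"
      and "T \<subseteq> tangent_lines \<and> openin (top_of_set unit_tangent_bundle) {p \<in> unit_tangent_bundle. tline p \<in> T}"
    moreover have "{p \<in> unit_tangent_bundle. tline p \<in> S \<inter> T} =
       {p \<in> unit_tangent_bundle. tline p \<in> S} \<inter> {p \<in> unit_tangent_bundle. tline p \<in> T}"
      by auto
    ultimately show "S \<inter> T \<subseteq> tangent_lines"
      "openin (top_of_set unit_tangent_bundle) {p \<in> unit_tangent_bundle. tline p \<in> S \<inter> T}"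
      by (auto intro: openin_Int)
  next
    fix K
    assume K: "\<forall>S\<in>K. S \<subseteq> tangent_lines \<and>
      openin (top_of_set unit_tangent_bundle) {p \<in> unit_tangent_bundle. tline p \<in> S}"
    then show "\<Union>K \<subseteq> tangent_lines" by blast
    have "{p \<in> unit_tangent_bundle. tline p \<in> \<Union>K} =
       (\<Union>S\<in>K. {p \<in> unit_tangent_bundle. tline p \<in> S})"
      by auto
    with K show "openin (top_of_set unit_tangent_bundle) {p \<in> unit_tangent_bundle. tline p \<in> \<Union>K}"
      by (auto intro: openin_Union)
  qed
  then show ?thesis
    by (simp add: tline_topology_def topology_inverse')
qed

lemma tline_image: "tline ` unit_tangent_bundle = tangent_lines"
  by (auto simp: tangent_lines_def tline_def quotient_def)

lemma topspace_tline_topology: "topspace tline_topology = tangent_lines"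
proof -
  have "{p \<in> unit_tangent_bundle. tline p \<in> tangent_lines} = unit_tangent_bundle"
    using tline_image by blast
  then have "openin tline_topology tangent_lines"
    by (simp add: openin_tline_topology)
  then show ?thesis
    by (meson openin_subset openin_topspace openin_tline_topology subset_antisym)
qed

lemma quotient_map_tline: "quotient_map (top_of_set unit_tangent_bundle) tline_topology tline"
  by (simp add: quotient_map_def topspace_tline_topology tline_image openin_tline_topology)

definition line_points :: "tline \<Rightarrow> (real^3) set" where
  "line_points l = {x + t *\<^sub>R \<xi> | x \<xi> t. (x, \<xi>) \<in> l}"

definition line_dist :: "tline \<Rightarrow> tline \<Rightarrow> real" where
  "line_dist u v = setdist (line_points u) (line_points v)"

text \<open>
  The six lines are indexed by pairs \<open>(i, s)\<close> with \<open>i\<close> between 1 and 3; the sign \<open>s\<close> is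
  \<^term>\<open>True\<close> for \<open>+\<close> and \<^term>\<open>False\<close> for \<open>-\<close>.  Six-tuples are extensional functions on
  these indices.
\<close>

type_synonym tuple6 = "nat \<times> bool \<Rightarrow> tline"

definition idx :: "(nat \<times> bool) set" where
  "idx = {1..3} \<times> UNIV"

definition tuple6_topology :: "tuple6 topology" where
  "tuple6_topology = product_topology (\<lambda>_. tline_topology) idx"

definition rotate_line :: "real^3^3 \<Rightarrow> tline \<Rightarrow> tline" where
  "rotate_line A l = (\<lambda>(x, \<xi>). (A *v x, A *v \<xi>)) ` l"

definition rotate6 :: "real^3^3 \<Rightarrow> tuple6 \<Rightarrow> tuple6" where
  "rotate6 A m = restrict (\<lambda>k. rotate_line A (m k)) idx"

definition O6 :: tuple6 where
  "O6 = restrict (\<lambda>(i, s).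
     let \<sigma> = (if s then 1 else - 1) in
     if i = 1 then tline (\<sigma> *\<^sub>R axis 1 1, axis 3 1)
     else if i = 2 then tline (\<sigma> *\<^sub>R axis 2 1, axis 1 1)
     else tline (\<sigma> *\<^sub>R axis 3 1, axis 2 1)) idx"

definition D_min :: "tuple6 \<Rightarrow> real" where
  "D_min m = Min {line_dist (m (i, s)) (m (j, t)) | i j s t. 1 \<le> i \<and> i < j \<and> j \<le> 3}"

text \<open>The set under \<^const>\<open>Min\<close> is finite and nonempty.\<close>

lemma D_min_finite:
  fixes m :: tuple6
  shows "finite {line_dist (m (i, s)) (m (j, t)) | i j s t. 1 \<le> i \<and> i < j \<and> j \<le> 3}"
proof (rule finite_subset)
  show "{line_dist (m (i, s)) (m (j, t)) | i j s t. 1 \<le> i \<and> i < j \<and> j \<le> 3}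
    \<subseteq> (\<lambda>(k, l). line_dist (m k) (m l)) ` (idx \<times> idx)"
    by (force simp: idx_def)
qed (simp add: idx_def)

lemma D_min_nonempty:
  fixes m :: tuple6
  shows "{line_dist (m (i, s)) (m (j, t)) | i j s t. 1 \<le> i \<and> i < j \<and> j \<le> 3} \<noteq> {}"
proof -
  have "1 \<le> (1::nat) \<and> (1::nat) < 2 \<and> (2::nat) \<le> 3" by simp
  then show ?thesis by blast
qed

end

theory Submission
  imports Defs
begin

text \<open>
  At the octahedral configuration, a six-dimensional space of infinitesimal deformations modulo
  rotations keeps all twelve distances stationary to first order, so the proof has to control
  second-order terms.

  Write the points of tangency as \<open>\<plusminus>X\<close> with the sign of the line, and attach to each line the
  orthonormal frame \<open>(X, M, \<xi>)\<close> with \<open>M = \<xi> \<times> X\<close>.  In the configuration itself, the frame of both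
  lines number \<open>i\<close> is \<open>(e\<^sub>i, e\<^sub>i\<^sub>+\<^sub>1, e\<^sub>i\<^sub>+\<^sub>2)\<close>, indices modulo 3; this is why the
  type \<open>3\<close> indexes the lines below.  Any two of the three numbers are consecutive modulo 3, so the
  twelve distances are those between a line \<open>(i, s)\<close> and a line \<open>(i + 1, t)\<close>.  The formula for
  the distance of two skew lines, written in these frames, shows that a distance of at least 1
  forces the contact inequality
  \<open>s t (M\<^sub>i\<^sub>s \<bullet> \<xi>\<^sub>i\<^sub>+\<^sub>1\<^sub>,\<^sub>t) \<ge> (\<xi>\<^sub>i\<^sub>s \<bullet> X\<^sub>i\<^sub>+\<^sub>1\<^sub>,\<^sub>t)\<^sup>2 / 2\<close>
  (lemma \<open>contact_inequality\<close>), near the octahedral configuration but without any error term.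

  Rotations are removed by measuring everything in the moving basis \<open>E\<close> given by the frame of
  the line \<open>(1, +)\<close>.  To first order the frame of a line has three coordinates: \<open>a = M \<bullet> E\<^sub>i\<close>,
  \<open>b = \<xi> \<bullet> E\<^sub>i\<close> and \<open>c = \<xi> \<bullet> E\<^sub>i\<^sub>+\<^sub>1\<close>; all are bounded by a small number \<open>\<epsilon>\<close>.  For fixed \<open>i\<close>
  the sum of the four left sides over \<open>s\<close> and \<open>t\<close> is
  \<open>(M\<^sub>i\<^sub>+ - M\<^sub>i\<^sub>-) \<bullet> (\<xi>\<^sub>i\<^sub>+\<^sub>1\<^sub>,\<^sub>+ - \<xi>\<^sub>i\<^sub>+\<^sub>1\<^sub>,\<^sub>-)\<close>: the first-order parts cancel, and what remains is
  \<open>- \<Delta>\<^sub>i \<Delta>\<^sub>i\<^sub>+\<^sub>1\<close> up to order \<open>\<epsilon>\<^sup>3\<close>, where \<open>\<Delta>\<^sub>i = c\<^sub>i\<^sub>+ - c\<^sub>i\<^sub>-\<close>.  The right sides add up to at least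
  \<open>\<Delta>\<^sub>i\<^sup>2 / 2\<close> up to the same order.  Moreover each left side is nonnegative, hence itself of order
  \<open>\<epsilon>\<^sup>2\<close>, which says \<open>a\<^sub>i\<^sub>s = - b\<^sub>i\<^sub>+\<^sub>1\<^sub>,\<^sub>t\<close> up to that order (lemma \<open>consecutive_pair_estimates\<close>).

  Without the error terms, \<open>\<Delta>\<^sub>i\<^sup>2 + 2 \<Delta>\<^sub>i \<Delta>\<^sub>i\<^sub>+\<^sub>1 \<le> 0\<close> for all three \<open>i\<close> would make the signs of the \<open>\<Delta>\<^sub>i\<close>
  alternate around a cycle of odd length, so all \<open>\<Delta>\<^sub>i\<close> would vanish.  No single choice of Lagrange
  multipliers gives this: it takes the three inequalities separately.  With the error terms the
  same argument bounds every \<open>\<Delta>\<^sub>i\<close>, and then every coordinate, by a multiple of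
  \<open>\<epsilon>\<^sup>3\<^sup>/\<^sup>2\<close> (lemmas \<open>alternating_three_cycle\<close> and \<open>coordinates_improve\<close>).  If \<open>\<epsilon>\<close> is the largest
  coordinate and is small enough, this is only possible for \<open>\<epsilon> = 0\<close>, and then all six frames are those of
  the configuration rotated to the basis \<open>E\<close> (lemma \<open>frames_rigid\<close>).
\<close>

section \<open>Tangent lines and their distances\<close>

lemma tline_pair:
  assumes "(x, \<xi>) \<in> unit_tangent_bundle"
  shows "tline (x, \<xi>) = {(x, \<xi>), (x, - \<xi>)}"
  using assms by (auto simp: tline_def flip_rel_def)

lemma tline_eq_iff:
  assumes "(x, \<xi>) \<in> unit_tangent_bundle"
  shows "tline (x, \<xi>) = tline (y, \<eta>) \<longleftrightarrow> y = x \<and> (\<eta> = \<xi> \<or> \<eta> = - \<xi>)"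
proof
  assume eq: "tline (x, \<xi>) = tline (y, \<eta>)"
  have "tline (y, \<eta>) \<noteq> {} \<longrightarrow> (y, \<eta>) \<in> tline (y, \<eta>)"
    by (auto simp: tline_def flip_rel_def)
  then show "y = x \<and> (\<eta> = \<xi> \<or> \<eta> = - \<xi>)"
    using eq tline_pair[OF assms] by auto
next
  assume "y = x \<and> (\<eta> = \<xi> \<or> \<eta> = - \<xi>)"
  then show "tline (x, \<xi>) = tline (y, \<eta>)"
    using assms by (auto simp: tline_def flip_rel_def unit_tangent_bundle_def)
qed

lemma line_points_tline:
  assumes "(x, \<xi>) \<in> unit_tangent_bundle"
  shows "line_points (tline (x, \<xi>)) = range (\<lambda>t. x + t *\<^sub>R \<xi>)"
proof -
  have "x - t *\<^sub>R \<xi> \<in> range (\<lambda>t. x + t *\<^sub>R \<xi>)" for t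
    by (rule image_eqI[of _ _ "- t"]) auto
  then show ?thesis
    unfolding line_points_def tline_pair[OF assms] by auto
qed

lemma line_dist_le:
  assumes "(x, \<xi>) \<in> unit_tangent_bundle" "(y, \<eta>) \<in> unit_tangent_bundle"
  shows "line_dist (tline (x, \<xi>)) (tline (y, \<eta>)) \<le> norm ((x + s *\<^sub>R \<xi>) - (y + t *\<^sub>R \<eta>))"
  unfolding line_dist_def line_points_tline[OF assms(1)] line_points_tline[OF assms(2)] dist_norm[symmetric]
  by (rule setdist_le_dist) auto

lemma line_dist_ge:
  assumes "(x, \<xi>) \<in> unit_tangent_bundle" "(y, \<eta>) \<in> unit_tangent_bundle"
    and "norm v = 1" "v \<bullet> \<xi> = 0" "v \<bullet> \<eta> = 0"
  shows "line_dist (tline (x, \<xi>)) (tline (y, \<eta>)) \<ge> \<bar>v \<bullet> (x - y)\<bar>"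
  unfolding line_dist_def line_points_tline[OF assms(1)] line_points_tline[OF assms(2)]
proof (rule le_setdistI)
  fix p q assume "p \<in> range (\<lambda>t. x + t *\<^sub>R \<xi>)" "q \<in> range (\<lambda>t. y + t *\<^sub>R \<eta>)"
  then obtain s t where "p = x + s *\<^sub>R \<xi>" "q = y + t *\<^sub>R \<eta>" by blast
  then have "v \<bullet> (x - y) = v \<bullet> (p - q)"
    using assms by (simp add: inner_diff_right inner_add_right)
  also have "\<bar>\<dots>\<bar> \<le> norm v * norm (p - q)" by (rule Cauchy_Schwarz_ineq2)
  finally show "\<bar>v \<bullet> (x - y)\<bar> \<le> dist p q" using assms by (simp add: dist_norm)
qed auto

lemma line_dist_sym: "line_dist u v = line_dist v u"
  by (simp add: line_dist_def setdist_sym)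

lemma common_perpendicular:
  fixes x y \<xi> \<eta> :: "real^3"
  assumes "norm \<xi> = 1" "norm \<eta> = 1" "(\<xi> \<bullet> \<eta>)\<^sup>2 \<noteq> 1"
  obtains s t where "((x + s *\<^sub>R \<xi>) - (y + t *\<^sub>R \<eta>)) \<bullet> \<xi> = 0"
    "((x + s *\<^sub>R \<xi>) - (y + t *\<^sub>R \<eta>)) \<bullet> \<eta> = 0"
proof -
  define k where "k = \<xi> \<bullet> \<eta>"
  define p where "p = (x - y) \<bullet> \<xi>"
  define q where "q = (x - y) \<bullet> \<eta>"
  define s where "s = (k * q - p) / (1 - k\<^sup>2)"
  define t where "t = (q - k * p) / (1 - k\<^sup>2)"
  have nz: "1 - k\<^sup>2 \<noteq> 0" using assms(3) by (simp add: k_def)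
  have u: "\<xi> \<bullet> \<xi> = 1" "\<eta> \<bullet> \<eta> = 1" using assms by (simp_all add: norm_eq_1)
  have "p + s - t * k = 0" "q + s * k - t = 0"
    using nz by (simp_all add: s_def t_def field_simps power2_eq_square)
  moreover have "((x + s *\<^sub>R \<xi>) - (y + t *\<^sub>R \<eta>)) \<bullet> \<xi> = p + s - t * k"
    "((x + s *\<^sub>R \<xi>) - (y + t *\<^sub>R \<eta>)) \<bullet> \<eta> = q + s * k - t"
    using u by (simp_all add: p_def q_def k_def inner_diff_left inner_add_left inner_commute[of \<eta> \<xi>])
  ultimately show thesis by (intro that) auto
qed

text \<open>
  On the common perpendicular, the vector between the two lines is parallel to \<open>\<xi> \<times> \<eta>\<close>, so its
  length times \<open>\<bar>\<xi> \<times> \<eta>\<bar>\<close> is the absolute value of the triple product of \<open>x - y\<close>, \<open>\<xi>\<close> and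
  \<open>\<eta>\<close>.  That triple product is the Pluecker pairing of the directions \<open>\<xi>\<close>, \<open>\<eta>\<close> with the moments
  \<open>x \<times> \<xi>\<close>, \<open>y \<times> \<eta>\<close>, the form used here.  For parallel lines the right-hand side is 0.
\<close>
lemma distance_ge_1_imp:
  assumes "(x, \<xi>) \<in> unit_tangent_bundle" "(y, \<eta>) \<in> unit_tangent_bundle"
    and "line_dist (tline (x, \<xi>)) (tline (y, \<eta>)) \<ge> 1"
  shows "(cross3 x \<xi> \<bullet> \<eta> + \<xi> \<bullet> cross3 y \<eta>)\<^sup>2 \<ge> 1 - (\<xi> \<bullet> \<eta>)\<^sup>2"
proof (cases "(\<xi> \<bullet> \<eta>)\<^sup>2 = 1")
  case False
  have u: "norm \<xi> = 1" "norm \<eta> = 1" using assms by (auto simp: unit_tangent_bundle_def)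
  obtain s t where st: "((x + s *\<^sub>R \<xi>) - (y + t *\<^sub>R \<eta>)) \<bullet> \<xi> = 0"
    "((x + s *\<^sub>R \<xi>) - (y + t *\<^sub>R \<eta>)) \<bullet> \<eta> = 0"
    using common_perpendicular[OF u False] .
  define v where "v = (x + s *\<^sub>R \<xi>) - (y + t *\<^sub>R \<eta>)"
  have "norm v \<ge> 1"
    using line_dist_le[OF assms(1,2), of s t] assms(3) by (simp add: v_def)
  then have v1: "(norm v)\<^sup>2 \<ge> 1" by simp
  have c: "(norm (cross3 \<xi> \<eta>))\<^sup>2 = 1 - (\<xi> \<bullet> \<eta>)\<^sup>2"
    using norm_cross_dot[of \<xi> \<eta>] u by simp
  have "cross3 v (cross3 \<xi> \<eta>) = 0"
    using st unfolding v_def[symmetric] by (simp add: Lagrange)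
  then have "(v \<bullet> cross3 \<xi> \<eta>)\<^sup>2 = (norm v)\<^sup>2 * (norm (cross3 \<xi> \<eta>))\<^sup>2"
    using norm_cross_dot[of v "cross3 \<xi> \<eta>"] by (simp add: power_mult_distrib)
  also have "\<dots> \<ge> 1 - (\<xi> \<bullet> \<eta>)\<^sup>2"
    unfolding c using v1 c by (metis mult_le_cancel_right1 zero_le_power2 not_le)
  moreover have "v \<bullet> cross3 \<xi> \<eta> = cross3 x \<xi> \<bullet> \<eta> + \<xi> \<bullet> cross3 y \<eta>"
    unfolding v_def by (simp add: cross3_simps inner_vec_def sum_3 cross3_def)
  ultimately show ?thesis by simp
qed simp

section \<open>Orthonormal frames\<close>

definition orthonormal3 :: "real^3 \<Rightarrow> real^3 \<Rightarrow> real^3 \<Rightarrow> bool" where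
  "orthonormal3 e f g \<longleftrightarrow> e \<bullet> e = 1 \<and> f \<bullet> f = 1 \<and> g \<bullet> g = 1 \<and> e \<bullet> f = 0 \<and> e \<bullet> g = 0 \<and> f \<bullet> g = 0"

lemma orthonormal3_rotate: "orthonormal3 e f g \<Longrightarrow> orthonormal3 f g e"
  by (simp add: orthonormal3_def inner_commute)

text \<open>Parseval's identity; it turns inner products of frame vectors into polynomials in coordinates.\<close>
lemma orthonormal3_expand:
  assumes "orthonormal3 e f g"
  shows "v \<bullet> w = (v \<bullet> e) * (w \<bullet> e) + (v \<bullet> f) * (w \<bullet> f) + (v \<bullet> g) * (w \<bullet> g)"
proof -
  define A :: "real^3^3" where "A = vector [e, f, g]"
  have "A ** transpose A = mat 1"
    using assms by (simp add: A_def vec_eq_iff matrix_matrix_mult_def transpose_def mat_def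
        forall_3 vector_3 sum_3 orthonormal3_def inner_vec_def mult.commute)
  then have "orthogonal_matrix A"
    using matrix_left_right_inverse by (auto simp: orthogonal_matrix)
  then have "orthogonal_transformation (\<lambda>x. A *v x)"
    by (simp add: orthogonal_transformation_matrix)
  then have "v \<bullet> w = (A *v v) \<bullet> (A *v w)"
    by (simp add: orthogonal_transformation_def)
  also have "\<dots> = (v \<bullet> e) * (w \<bullet> e) + (v \<bullet> f) * (w \<bullet> f) + (v \<bullet> g) * (w \<bullet> g)"
    by (simp add: A_def inner_vec_def[of "_ *v _"] matrix_vector_mul_component sum_3 vector_3 inner_commute)
  finally show ?thesis .
qed

lemma orthonormal3_cross:
  assumes "norm X = 1" "norm \<xi> = 1" "X \<bullet> \<xi> = 0"
  shows "orthonormal3 X (cross3 \<xi> X) \<xi>"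
proof -
  have "(norm (cross3 \<xi> X))\<^sup>2 = 1"
    using norm_cross_dot[of \<xi> X] assms by (simp add: inner_commute)
  then show ?thesis using assms
    by (auto simp: orthonormal3_def dot_cross_self norm_eq_1 power2_norm_eq_inner inner_commute)
qed

section \<open>The contact inequality\<close>

text \<open>
  The hypotheses say \<open>\<mu> \<ge> sqrt (p\<^sup>2 + r\<^sup>2) - p\<close>.  The product of this difference with
  \<open>sqrt (p\<^sup>2 + r\<^sup>2) + p\<close>, a number between 0 and 2, is \<open>r\<^sup>2\<close>.
\<close>
lemma sqrt_gap:
  fixes p r \<mu> :: real
  assumes "p\<^sup>2 + r\<^sup>2 \<le> 1" "p + \<mu> \<ge> 0" "(p + \<mu>)\<^sup>2 \<ge> p\<^sup>2 + r\<^sup>2"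
  shows "\<mu> \<ge> r\<^sup>2 / 2"
proof -
  have "p \<le> 1 - r\<^sup>2 / 2"
  proof (rule power2_le_imp_le)
    show "p\<^sup>2 \<le> (1 - r\<^sup>2 / 2)\<^sup>2"
    proof -
      have "(1 - r\<^sup>2 / 2)\<^sup>2 = 1 - r\<^sup>2 + (r\<^sup>2 / 2)\<^sup>2" by (simp add: power2_diff)
      then show ?thesis using assms(1) zero_le_power2[of "r\<^sup>2 / 2"] by linarith
    qed
    show "0 \<le> 1 - r\<^sup>2 / 2" using assms(1) by (smt (verit) zero_le_power2 field_sum_of_halves)
  qed
  then have "r\<^sup>2 * p \<le> r\<^sup>2 * (1 - r\<^sup>2 / 2)" by (simp add: mult_left_mono)
  then have "(p + r\<^sup>2 / 2)\<^sup>2 \<le> p\<^sup>2 + r\<^sup>2"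
    using zero_le_power[of "r\<^sup>2" 2] by (simp add: power2_sum power_divide power2_eq_square algebra_simps)
  then have "(p + r\<^sup>2 / 2)\<^sup>2 \<le> (p + \<mu>)\<^sup>2" using assms(3) by linarith
  then have "p + r\<^sup>2 / 2 \<le> p + \<mu>" using assms(2) by (rule power2_le_imp_le)
  then show ?thesis by simp
qed

definition sg :: "bool \<Rightarrow> real" where "sg s = (if s then 1 else - 1)"

lemma sg_simps [simp]: "sg True = 1" "sg False = - 1" "sg s * sg s = 1" "\<bar>sg s\<bar> = 1"
  by (auto simp: sg_def)

text \<open>
  In the frame \<open>(Y, N, \<eta>)\<close> with \<open>N = \<eta> \<times> Y\<close>, the quantity \<open>1 - (\<xi> \<bullet> \<eta>)\<^sup>2\<close> splits as
  \<open>(\<xi> \<bullet> N)\<^sup>2 + (\<xi> \<bullet> Y)\<^sup>2\<close>, and the Pluecker pairing is, up to sign, \<open>\<xi> \<bullet> N\<close> plus the left side of the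
  conclusion.  Taking a square root leaves a lower bound for the left side by an exact square.
  The assumption \<open>pos\<close> selects the positive square root and holds near the octahedral
  configuration, where \<open>\<xi> \<bullet> N\<close> is close to 1 and \<open>\<xi> \<times> X \<bullet> \<eta>\<close> close to 0.
\<close>
lemma contact_inequality:
  assumes XM: "orthonormal3 X (cross3 \<xi> X) \<xi>" and YN: "orthonormal3 Y (cross3 \<eta> Y) \<eta>"
    and far: "line_dist (tline (sg s *\<^sub>R X, \<xi>)) (tline (sg t *\<^sub>R Y, \<eta>)) \<ge> 1"
    and pos: "\<xi> \<bullet> cross3 \<eta> Y + sg s * sg t * (cross3 \<xi> X \<bullet> \<eta>) \<ge> 0"
  shows "sg s * sg t * (cross3 \<xi> X \<bullet> \<eta>) \<ge> (\<xi> \<bullet> Y)\<^sup>2 / 2"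
proof -
  have utb: "(sg s *\<^sub>R X, \<xi>) \<in> unit_tangent_bundle" "(sg t *\<^sub>R Y, \<eta>) \<in> unit_tangent_bundle"
    using XM YN by (auto simp: unit_tangent_bundle_def orthonormal3_def norm_eq_1)
  let ?p = "\<xi> \<bullet> cross3 \<eta> Y" and ?\<mu> = "sg s * sg t * (cross3 \<xi> X \<bullet> \<eta>)"
  have "cross3 (sg s *\<^sub>R X) \<xi> \<bullet> \<eta> + \<xi> \<bullet> cross3 (sg t *\<^sub>R Y) \<eta> = - sg s * (cross3 \<xi> X \<bullet> \<eta>) - sg t * ?p"
    by (simp add: cross_mult_left cross_skew[of X \<xi>] cross_skew[of Y \<eta>])
  also have "\<dots> = - sg t * (?p + ?\<mu>)"
    by (cases s; cases t) (simp_all)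
  finally have "(cross3 (sg s *\<^sub>R X) \<xi> \<bullet> \<eta> + \<xi> \<bullet> cross3 (sg t *\<^sub>R Y) \<eta>)\<^sup>2 = (?p + ?\<mu>)\<^sup>2"
    by (simp add: power_mult_distrib sg_def)
  with distance_ge_1_imp[OF utb far] have far': "(?p + ?\<mu>)\<^sup>2 \<ge> 1 - (\<xi> \<bullet> \<eta>)\<^sup>2" by simp
  have "\<xi> \<bullet> \<xi> = (\<xi> \<bullet> Y)\<^sup>2 + ?p\<^sup>2 + (\<xi> \<bullet> \<eta>)\<^sup>2"
    using orthonormal3_expand[OF YN, of \<xi> \<xi>] by (simp add: power2_eq_square)
  then have split: "?p\<^sup>2 + (\<xi> \<bullet> Y)\<^sup>2 = 1 - (\<xi> \<bullet> \<eta>)\<^sup>2"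
    using XM by (simp add: orthonormal3_def)
  show ?thesis
    by (rule sqrt_gap[OF _ pos]) (use split far' zero_le_power2[of "\<xi> \<bullet> \<eta>"] in linarith)+
qed

section \<open>Frames close to a given orthonormal basis\<close>

lemma abs_mult_le:
  fixes x y u v :: real
  assumes "\<bar>x\<bar> \<le> u" "\<bar>y\<bar> \<le> v" shows "\<bar>x * y\<bar> \<le> u * v"
  using assms by (simp add: abs_mult mult_mono')

lemma abs_diff_le:
  fixes x y u v :: real
  assumes "\<bar>x\<bar> \<le> u" "\<bar>y\<bar> \<le> v" shows "\<bar>x - y\<bar> \<le> u + v"
  using assms by linarith

text \<open>
  A rotation matrix near the identity is determined by three small entries: the diagonal is 1 up
  to second order, and opposite off-diagonal entries cancel up to second order.  The rows
  \<open>(p, q, r)\<close>, \<open>(a, m, n)\<close> and \<open>(b, c, k)\<close> are the coordinates of \<open>X\<close>, \<open>M\<close> and \<open>\<xi>\<close>; the bounds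
  are derived from the last row upwards because only \<open>a\<close>, \<open>b\<close> and \<open>c\<close> are controlled at the start.
\<close>
lemma nearly_identity_entries:
  fixes a b c k m n p q r \<epsilon> :: real
  assumes \<epsilon>: "0 \<le> \<epsilon>" "\<epsilon> \<le> 1/100"
    and abc: "\<bar>a\<bar> \<le> \<epsilon>" "\<bar>b\<bar> \<le> \<epsilon>" "\<bar>c\<bar> \<le> \<epsilon>"
    and pos: "k > 0" "m > 0" "p > 0"
    and unit: "p*p + q*q + r*r = 1" "a*a + m*m + n*n = 1" "b*b + c*c + k*k = 1"
    and orth: "p*a + q*m + r*n = 0" "p*b + q*c + r*k = 0" "a*b + m*c + n*k = 0"
  shows "\<bar>1 - k\<bar> \<le> 2 * \<epsilon>\<^sup>2" "k \<le> 1" "\<bar>1 - m\<bar> \<le> 5 * \<epsilon>\<^sup>2" "m \<le> 1" "\<bar>n\<bar> \<le> 2 * \<epsilon>" "\<bar>n + c\<bar> \<le> 2 * \<epsilon>\<^sup>2"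
    "\<bar>1 - p\<bar> \<le> 20 * \<epsilon>\<^sup>2" "\<bar>q\<bar> \<le> 4 * \<epsilon>" "\<bar>r\<bar> \<le> 2 * \<epsilon>" "\<bar>q + a\<bar> \<le> 5 * \<epsilon>\<^sup>2"
proof -
  have e2: "\<epsilon>\<^sup>2 \<le> \<epsilon> / 100" using \<epsilon> mult_left_mono[of \<epsilon> "1/100" \<epsilon>] by (simp add: power2_eq_square)
  have e3: "\<epsilon> * \<epsilon>\<^sup>2 \<le> \<epsilon>\<^sup>2 / 100" using \<epsilon> mult_right_mono[of \<epsilon> "1/100" "\<epsilon>\<^sup>2"] by simp
  have le1: "x \<le> 1" if "x * x \<le> 1" for x :: real
    by (rule power2_le_imp_le) (use that in \<open>simp_all add: power2_eq_square\<close>)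
  have def1: "\<bar>1 - x\<bar> \<le> \<delta>" if "x > 0" "1 - x * x \<le> \<delta>" "x * x \<le> 1" for x \<delta> :: real
    using that le1[OF that(3)] mult_left_mono[of x 1 x] by linarith
  have sq: "x * x \<le> (C * \<epsilon>)\<^sup>2" if "\<bar>x\<bar> \<le> C * \<epsilon>" for x C
    using abs_mult_le[OF that that] by (simp add: power2_eq_square)
  have sqnn: "x * x \<ge> 0" for x :: real by simp
  have a2: "a*a \<le> \<epsilon>\<^sup>2" "b*b \<le> \<epsilon>\<^sup>2" "c*c \<le> \<epsilon>\<^sup>2"
    using sq[of a 1] sq[of b 1] sq[of c 1] abc by simp_all
  show k: "k \<le> 1" by (rule le1) (use unit(3) sqnn[of b] sqnn[of c] in linarith)
  show k2: "\<bar>1 - k\<bar> \<le> 2 * \<epsilon>\<^sup>2"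
    by (rule def1[OF pos(1)]) (use unit(3) a2 sqnn[of b] sqnn[of c] in linarith)+
  show m: "m \<le> 1" by (rule le1) (use unit(2) sqnn[of a] sqnn[of n] in linarith)
  have p: "p \<le> 1" by (rule le1) (use unit(1) sqnn[of q] sqnn[of r] in linarith)
  have divide: "\<bar>x\<bar> \<le> \<delta> / \<kappa>" if "\<bar>x * y\<bar> \<le> \<delta>" "\<kappa> \<le> y" "0 < \<kappa>" for x y \<delta> \<kappa> :: real
  proof -
    have "\<bar>x\<bar> * \<kappa> \<le> \<bar>x\<bar> * y" using that by (intro mult_left_mono) auto
    also have "\<dots> \<le> \<delta>" using that by (simp add: abs_mult)
    finally show ?thesis using that(3) by (simp add: field_simps)
  qed
  have "\<bar>n * k\<bar> \<le> \<bar>a * b\<bar> + \<bar>m * c\<bar>" using orth(3) by linarith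
  also have "\<dots> \<le> \<epsilon> * \<epsilon> + 1 * \<epsilon>"
    using m pos abc by (intro add_mono abs_mult_le) auto
  finally have "\<bar>n * k\<bar> \<le> 3/2 * \<epsilon>" using e2 \<epsilon> by (simp add: power2_eq_square)
  from divide[OF this, of "3/4"] show n: "\<bar>n\<bar> \<le> 2 * \<epsilon>" using k2 e2 \<epsilon> by simp
  have n2: "n*n \<le> 4 * \<epsilon>\<^sup>2" using sq[OF n] by (simp add: power_mult_distrib)
  show m2: "\<bar>1 - m\<bar> \<le> 5 * \<epsilon>\<^sup>2"
    by (rule def1[OF pos(2)]) (use unit(2) a2 n2 sqnn[of a] sqnn[of n] in linarith)+
  have "n + c = n * (1 - k) + (1 - m) * c - a * b" using orth(3) by (simp add: algebra_simps)
  then have "\<bar>n + c\<bar> \<le> \<bar>n * (1 - k)\<bar> + \<bar>(1 - m) * c\<bar> + \<bar>a * b\<bar>" by linarith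
  also have "\<dots> \<le> 2 * \<epsilon> * (2 * \<epsilon>\<^sup>2) + 5 * \<epsilon>\<^sup>2 * \<epsilon> + \<epsilon> * \<epsilon>"
    by (intro add_mono abs_mult_le n k2 m2 abc)
  also have "\<dots> = 9 * (\<epsilon> * \<epsilon>\<^sup>2) + \<epsilon>\<^sup>2" by (simp add: power2_eq_square)
  finally show "\<bar>n + c\<bar> \<le> 2 * \<epsilon>\<^sup>2" using e3 zero_le_power2[of \<epsilon>] by linarith
  have r1: "\<bar>r\<bar> \<le> 1"
    by (rule power2_le_imp_le)
      (use unit(1) sqnn[of p] sqnn[of q] in \<open>unfold power2_abs power2_eq_square, linarith+\<close>)
  have "\<bar>q * m\<bar> \<le> \<bar>p * a\<bar> + \<bar>r * n\<bar>" using orth(1) by linarith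
  also have "\<dots> \<le> 1 * \<epsilon> + 1 * (2 * \<epsilon>)"
    using p pos abc n r1 by (intro add_mono abs_mult_le) auto
  finally have "\<bar>q * m\<bar> \<le> 3 * \<epsilon>" by simp
  from divide[OF this, of "3/4"] show q: "\<bar>q\<bar> \<le> 4 * \<epsilon>" using m2 e2 \<epsilon> by simp
  have "\<bar>r * k\<bar> \<le> \<bar>p * b\<bar> + \<bar>q * c\<bar>" using orth(2) by linarith
  also have "\<dots> \<le> 1 * \<epsilon> + 4 * \<epsilon> * \<epsilon>"
    using p pos abc q by (intro add_mono abs_mult_le) auto
  finally have "\<bar>r * k\<bar> \<le> 3/2 * \<epsilon>" using e2 \<epsilon> by (simp add: power2_eq_square)
  from divide[OF this, of "3/4"] show r: "\<bar>r\<bar> \<le> 2 * \<epsilon>" using k2 e2 \<epsilon> by simp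
  have "q*q \<le> 16 * \<epsilon>\<^sup>2" "r*r \<le> 4 * \<epsilon>\<^sup>2" using sq[OF q] sq[OF r] by (simp_all add: power_mult_distrib)
  then show p2: "\<bar>1 - p\<bar> \<le> 20 * \<epsilon>\<^sup>2"
    by (intro def1[OF pos(3)]) (use unit(1) sqnn[of q] sqnn[of r] in linarith)+
  have "q + a = q * (1 - m) + (1 - p) * a - r * n" using orth(1) by (simp add: algebra_simps)
  then have "\<bar>q + a\<bar> \<le> \<bar>q * (1 - m)\<bar> + \<bar>(1 - p) * a\<bar> + \<bar>r * n\<bar>" by linarith
  also have "\<dots> \<le> 4 * \<epsilon> * (5 * \<epsilon>\<^sup>2) + 20 * \<epsilon>\<^sup>2 * \<epsilon> + 2 * \<epsilon> * (2 * \<epsilon>)"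
    by (intro add_mono abs_mult_le q m2 p2 abc r n)
  also have "\<dots> = 40 * (\<epsilon> * \<epsilon>\<^sup>2) + 4 * \<epsilon>\<^sup>2" by (simp add: power2_eq_square)
  finally show "\<bar>q + a\<bar> \<le> 5 * \<epsilon>\<^sup>2" using e3 zero_le_power2[of \<epsilon>] by linarith
qed

text \<open>
  The three bounded entries are the free coordinates \<open>a\<close>, \<open>b\<close>, \<open>c\<close> of a nearby frame, and the
  positivity conditions exclude the frames that differ from \<open>(e, f, g)\<close> by signs.  Bounding only
  free coordinates makes it possible to take \<open>\<epsilon>\<close> as their maximum later.
\<close>
definition near_frame :: "real \<Rightarrow> real^3 \<Rightarrow> real^3 \<Rightarrow> real^3 \<Rightarrow> real^3 \<Rightarrow> real^3 \<Rightarrow> real^3 \<Rightarrow> bool" where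
  "near_frame \<epsilon> e f g X M \<xi> \<longleftrightarrow> orthonormal3 X M \<xi> \<and> X \<bullet> e > 0 \<and> M \<bullet> f > 0 \<and> \<xi> \<bullet> g > 0
     \<and> \<bar>M \<bullet> e\<bar> \<le> \<epsilon> \<and> \<bar>\<xi> \<bullet> e\<bar> \<le> \<epsilon> \<and> \<bar>\<xi> \<bullet> f\<bar> \<le> \<epsilon>"

lemma near_frame_entries:
  assumes "orthonormal3 e f g" "near_frame \<epsilon> e f g X M \<xi>" "0 \<le> \<epsilon>" "\<epsilon> \<le> 1/100"
  shows "\<bar>1 - \<xi> \<bullet> g\<bar> \<le> 2 * \<epsilon>\<^sup>2" "\<xi> \<bullet> g \<le> 1" "\<bar>1 - M \<bullet> f\<bar> \<le> 5 * \<epsilon>\<^sup>2" "M \<bullet> f \<le> 1" "\<bar>M \<bullet> g\<bar> \<le> 2 * \<epsilon>"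
    "\<bar>M \<bullet> g + \<xi> \<bullet> f\<bar> \<le> 2 * \<epsilon>\<^sup>2" "\<bar>1 - X \<bullet> e\<bar> \<le> 20 * \<epsilon>\<^sup>2" "\<bar>X \<bullet> f\<bar> \<le> 4 * \<epsilon>" "\<bar>X \<bullet> g\<bar> \<le> 2 * \<epsilon>"
    "\<bar>X \<bullet> f + M \<bullet> e\<bar> \<le> 5 * \<epsilon>\<^sup>2"
proof -
  note ex = orthonormal3_expand[OF assms(1), symmetric]
  have products:
    "(X \<bullet> e) * (X \<bullet> e) + (X \<bullet> f) * (X \<bullet> f) + (X \<bullet> g) * (X \<bullet> g) = 1"
    "(M \<bullet> e) * (M \<bullet> e) + (M \<bullet> f) * (M \<bullet> f) + (M \<bullet> g) * (M \<bullet> g) = 1"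
    "(\<xi> \<bullet> e) * (\<xi> \<bullet> e) + (\<xi> \<bullet> f) * (\<xi> \<bullet> f) + (\<xi> \<bullet> g) * (\<xi> \<bullet> g) = 1"
    "(X \<bullet> e) * (M \<bullet> e) + (X \<bullet> f) * (M \<bullet> f) + (X \<bullet> g) * (M \<bullet> g) = 0"
    "(X \<bullet> e) * (\<xi> \<bullet> e) + (X \<bullet> f) * (\<xi> \<bullet> f) + (X \<bullet> g) * (\<xi> \<bullet> g) = 0"
    "(M \<bullet> e) * (\<xi> \<bullet> e) + (M \<bullet> f) * (\<xi> \<bullet> f) + (M \<bullet> g) * (\<xi> \<bullet> g) = 0"
    using assms(2) by (simp_all add: ex near_frame_def orthonormal3_def)
  have bounds: "\<bar>M \<bullet> e\<bar> \<le> \<epsilon>" "\<bar>\<xi> \<bullet> e\<bar> \<le> \<epsilon>" "\<bar>\<xi> \<bullet> f\<bar> \<le> \<epsilon>"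
    "\<xi> \<bullet> g > 0" "M \<bullet> f > 0" "X \<bullet> e > 0"
    using assms(2) by (simp_all add: near_frame_def)
  show "\<bar>1 - \<xi> \<bullet> g\<bar> \<le> 2 * \<epsilon>\<^sup>2" "\<xi> \<bullet> g \<le> 1" "\<bar>1 - M \<bullet> f\<bar> \<le> 5 * \<epsilon>\<^sup>2" "M \<bullet> f \<le> 1" "\<bar>M \<bullet> g\<bar> \<le> 2 * \<epsilon>"
    "\<bar>M \<bullet> g + \<xi> \<bullet> f\<bar> \<le> 2 * \<epsilon>\<^sup>2" "\<bar>1 - X \<bullet> e\<bar> \<le> 20 * \<epsilon>\<^sup>2" "\<bar>X \<bullet> f\<bar> \<le> 4 * \<epsilon>" "\<bar>X \<bullet> g\<bar> \<le> 2 * \<epsilon>"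
    "\<bar>X \<bullet> f + M \<bullet> e\<bar> \<le> 5 * \<epsilon>\<^sup>2"
    using nearly_identity_entries[OF assms(3,4) bounds products] by simp_all
qed

section \<open>Second-order consequences of four contact inequalities\<close>

text \<open>
  Here \<open>\<xi> \<bullet> f\<close>, \<open>M' \<bullet> f\<close> and \<open>\<xi>' \<bullet> g\<close> are the coordinates \<open>c\<close> of the first pair of lines and \<open>a'\<close>,
  \<open>c'\<close> of the second.  Summed over both signs, the left sides of the contact inequalities become the
  inner product of the differences of \<open>M\<close> and of \<open>\<xi>'\<close>.  A diagonal entry of a nearby frame varies
  only to second order, so just the \<open>g\<close>-components contribute to second order, and their product is that of the
  differences of \<open>c\<close> and \<open>c'\<close> with a minus sign.  Comparison with the right sides gives the second claim.
  Each left side is nonnegative and at most the sum, hence of second order; that is the first claim.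
\<close>
lemma consecutive_pair_estimates:
  fixes X M \<xi> X' M' \<xi>' :: "bool \<Rightarrow> real^3"
  assumes efg: "orthonormal3 e f g" and \<epsilon>: "0 \<le> \<epsilon>" "\<epsilon> \<le> 1/100"
    and near: "\<And>s. near_frame \<epsilon> e f g (X s) (M s) (\<xi> s)"
    and near': "\<And>t. near_frame \<epsilon> f g e (X' t) (M' t) (\<xi>' t)"
    and contact: "\<And>s t. sg s * sg t * (M s \<bullet> \<xi>' t) \<ge> (\<xi> s \<bullet> X' t)\<^sup>2 / 2"
  shows "\<bar>M s \<bullet> e + \<xi>' t \<bullet> f\<bar> \<le> 12 * \<epsilon>\<^sup>2"
    and "(\<Sum>s\<in>UNIV. \<Sum>t\<in>UNIV. (\<xi> s \<bullet> f - M' t \<bullet> f)\<^sup>2) / 2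
      \<le> - (\<xi> True \<bullet> f - \<xi> False \<bullet> f) * (\<xi>' True \<bullet> g - \<xi>' False \<bullet> g) + 100 * (\<epsilon> * \<epsilon>\<^sup>2)"
proof -
  have e3: "\<epsilon> * \<epsilon>\<^sup>2 \<le> \<epsilon>\<^sup>2 / 100" using \<epsilon> mult_right_mono[of \<epsilon> "1/100" "\<epsilon>\<^sup>2"] by simp
  have nn: "0 \<le> \<epsilon>\<^sup>2" "0 \<le> \<epsilon> * \<epsilon>\<^sup>2" using \<epsilon> by simp_all
  have fge: "orthonormal3 f g e" using efg by (rule orthonormal3_rotate)
  note E = near_frame_entries[OF efg near \<epsilon>]
  note E' = near_frame_entries[OF fge near' \<epsilon>]
  have small: "\<bar>M s \<bullet> e\<bar> \<le> \<epsilon>" "\<bar>\<xi> s \<bullet> e\<bar> \<le> \<epsilon>" "\<bar>\<xi> s \<bullet> f\<bar> \<le> \<epsilon>"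
    "\<bar>M' s \<bullet> f\<bar> \<le> \<epsilon>" "\<bar>\<xi>' s \<bullet> f\<bar> \<le> \<epsilon>" "\<bar>\<xi>' s \<bullet> g\<bar> \<le> \<epsilon>" for s
    using near[of s] near'[of s] by (simp_all add: near_frame_def)
  define \<mu> where "\<mu> s t = sg s * sg t * (M s \<bullet> \<xi>' t)" for s t
  have \<mu>_nonneg: "\<mu> s t \<ge> 0" for s t
    using contact[of s t] zero_le_power2[of "\<xi> s \<bullet> X' t"] unfolding \<mu>_def by linarith
  define \<Sigma> where "\<Sigma> = \<mu> True True + \<mu> True False + \<mu> False True + \<mu> False False"
  \<comment> \<open>The signs \<open>s t\<close> turn the sum of four products into a product of two differences.\<close>
  have \<Sigma>: "\<Sigma> = (M True \<bullet> e - M False \<bullet> e) * (\<xi>' True \<bullet> e - \<xi>' False \<bullet> e)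
      + (M True \<bullet> f - M False \<bullet> f) * (\<xi>' True \<bullet> f - \<xi>' False \<bullet> f)
      + (M True \<bullet> g - M False \<bullet> g) * (\<xi>' True \<bullet> g - \<xi>' False \<bullet> g)"
    unfolding \<Sigma>_def \<mu>_def
    by (simp add: orthonormal3_expand[OF efg, of "M _" "\<xi>' _"] algebra_simps)
  have k'd: "\<bar>\<xi>' True \<bullet> e - \<xi>' False \<bullet> e\<bar> \<le> 2 * \<epsilon>\<^sup>2"
    using E'(1,2)[of True] E'(1,2)[of False] by linarith
  have md: "\<bar>M True \<bullet> f - M False \<bullet> f\<bar> \<le> 5 * \<epsilon>\<^sup>2"
    using E(3,4)[of True] E(3,4)[of False] by linarith
  have ad: "\<bar>M True \<bullet> e - M False \<bullet> e\<bar> \<le> 2 * \<epsilon>" and b'd: "\<bar>\<xi>' True \<bullet> f - \<xi>' False \<bullet> f\<bar> \<le> 2 * \<epsilon>"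
    and cd: "\<bar>\<xi> True \<bullet> f - \<xi> False \<bullet> f\<bar> \<le> 2 * \<epsilon>" and c'd: "\<bar>\<xi>' True \<bullet> g - \<xi>' False \<bullet> g\<bar> \<le> 2 * \<epsilon>"
    using abs_diff_le[OF small(1) small(1)] abs_diff_le[OF small(5) small(5)]
      abs_diff_le[OF small(3) small(3)] abs_diff_le[OF small(6) small(6)] by simp_all
  let ?\<Delta> = "\<xi> True \<bullet> f - \<xi> False \<bullet> f" and ?\<Delta>' = "\<xi>' True \<bullet> g - \<xi>' False \<bullet> g"
  have \<Sigma>_le: "\<Sigma> \<le> - ?\<Delta> * ?\<Delta>' + 22 * (\<epsilon> * \<epsilon>\<^sup>2)"
  proof -
    have nd: "\<bar>(M True \<bullet> g - M False \<bullet> g) + ?\<Delta>\<bar> \<le> 4 * \<epsilon>\<^sup>2"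
      using E(6)[of True] E(6)[of False] by linarith
    have "(M True \<bullet> g - M False \<bullet> g) * ?\<Delta>' = - ?\<Delta> * ?\<Delta>' + ((M True \<bullet> g - M False \<bullet> g) + ?\<Delta>) * ?\<Delta>'"
      by (simp add: algebra_simps)
    then have "\<Sigma> \<le> 2 * \<epsilon> * (2 * \<epsilon>\<^sup>2) + 5 * \<epsilon>\<^sup>2 * (2 * \<epsilon>) - ?\<Delta> * ?\<Delta>' + 4 * \<epsilon>\<^sup>2 * (2 * \<epsilon>)"
      unfolding \<Sigma>
      using abs_mult_le[OF ad k'd] abs_mult_le[OF md b'd] abs_mult_le[OF nd c'd] by linarith
    also have "\<dots> = - ?\<Delta> * ?\<Delta>' + 22 * (\<epsilon> * \<epsilon>\<^sup>2)" by (simp add: algebra_simps)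
    finally show ?thesis .
  qed
  have "- ?\<Delta> * ?\<Delta>' \<le> 4 * \<epsilon>\<^sup>2"
  proof -
    have "- ?\<Delta> * ?\<Delta>' = - (?\<Delta> * ?\<Delta>')" "2 * \<epsilon> * (2 * \<epsilon>) = 4 * \<epsilon>\<^sup>2"
      by (simp_all add: power2_eq_square algebra_simps)
    then show ?thesis using abs_mult_le[OF cd c'd] by linarith
  qed
  then have "\<Sigma> \<le> 9 * \<epsilon>\<^sup>2" using \<Sigma>_le e3 nn by linarith
  then have \<mu>_le: "\<mu> s t \<le> 9 * \<epsilon>\<^sup>2" for s t
    using \<mu>_nonneg[of True True] \<mu>_nonneg[of True False] \<mu>_nonneg[of False True] \<mu>_nonneg[of False False]
    by (cases s; cases t) (simp_all add: \<Sigma>_def)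
  have first: "\<bar>M s \<bullet> e + \<xi>' t \<bullet> f\<bar> \<le> 12 * \<epsilon>\<^sup>2" for s t
  proof -
    have "\<bar>M s \<bullet> \<xi>' t\<bar> \<le> 9 * \<epsilon>\<^sup>2"
      using \<mu>_nonneg[of s t] \<mu>_le[of s t] by (cases s; cases t) (simp_all add: \<mu>_def)
    moreover have "M s \<bullet> e + \<xi>' t \<bullet> f
        = M s \<bullet> \<xi>' t + (M s \<bullet> e) * (1 - \<xi>' t \<bullet> e) + (1 - M s \<bullet> f) * (\<xi>' t \<bullet> f) - (M s \<bullet> g) * (\<xi>' t \<bullet> g)"
      by (simp add: orthonormal3_expand[OF efg, of "M s" "\<xi>' t"] algebra_simps)
    ultimately have "\<bar>M s \<bullet> e + \<xi>' t \<bullet> f\<bar> \<le> 9 * \<epsilon>\<^sup>2 + \<epsilon> * (2 * \<epsilon>\<^sup>2) + 5 * \<epsilon>\<^sup>2 * \<epsilon> + 2 * \<epsilon> * \<epsilon>"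
      using abs_mult_le[OF small(1)[of s] E'(1)[of t]] abs_mult_le[OF E(3)[of s] small(5)[of t]]
        abs_mult_le[OF E(5)[of s] small(6)[of t]] by linarith
    also have "\<dots> = 11 * \<epsilon>\<^sup>2 + 7 * (\<epsilon> * \<epsilon>\<^sup>2)" by (simp add: power2_eq_square)
    finally show ?thesis using e3 nn by linarith
  qed
  then show "\<bar>M s \<bullet> e + \<xi>' t \<bullet> f\<bar> \<le> 12 * \<epsilon>\<^sup>2" .
  \<comment> \<open>The number squared in the contact inequality is \<open>\<xi> \<bullet> f - M' \<bullet> f\<close> up to second order.\<close>
  have contact': "(\<xi> s \<bullet> f - M' t \<bullet> f)\<^sup>2 / 2 \<le> \<mu> s t + 16 * (\<epsilon> * \<epsilon>\<^sup>2)" for s t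
  proof -
    define y where "y = \<xi> s \<bullet> f - M' t \<bullet> f"
    define \<theta> where "\<theta> = \<xi> s \<bullet> X' t - y"
    have "\<theta> = (\<xi> s \<bullet> e) * (X' t \<bullet> e) - (\<xi> s \<bullet> f) * (1 - X' t \<bullet> f) + (X' t \<bullet> g + M' t \<bullet> f)
        - (1 - \<xi> s \<bullet> g) * (X' t \<bullet> g)"
      by (simp add: \<theta>_def y_def orthonormal3_expand[OF efg, of "\<xi> s" "X' t"] algebra_simps)
    then have "\<bar>\<theta>\<bar> \<le> \<epsilon> * (2 * \<epsilon>) + \<epsilon> * (20 * \<epsilon>\<^sup>2) + 5 * \<epsilon>\<^sup>2 + 2 * \<epsilon>\<^sup>2 * (4 * \<epsilon>)"
      using abs_mult_le[OF small(2)[of s] E'(9)[of t]] abs_mult_le[OF small(3)[of s] E'(7)[of t]]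
        E'(10)[of t] abs_mult_le[OF E(1)[of s] E'(8)[of t]] by linarith
    also have "\<dots> = 7 * \<epsilon>\<^sup>2 + 28 * (\<epsilon> * \<epsilon>\<^sup>2)" by (simp add: power2_eq_square)
    finally have \<theta>: "\<bar>\<theta>\<bar> \<le> 8 * \<epsilon>\<^sup>2" using e3 nn by linarith
    have y: "\<bar>y\<bar> \<le> 2 * \<epsilon>" using small(3)[of s] small(4)[of t] unfolding y_def by linarith
    have "y\<^sup>2 = (y + \<theta>)\<^sup>2 - 2 * (y * \<theta>) - \<theta>\<^sup>2" by (simp add: power2_sum)
    then have "y\<^sup>2 \<le> (y + \<theta>)\<^sup>2 + 2 * (2 * \<epsilon> * (8 * \<epsilon>\<^sup>2))"
      using abs_mult_le[OF y \<theta>] zero_le_power2[of \<theta>] by linarith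
    moreover have "(y + \<theta>)\<^sup>2 / 2 \<le> \<mu> s t" using contact[of s t] by (simp add: \<theta>_def \<mu>_def)
    ultimately show ?thesis unfolding y_def[symmetric] by simp
  qed
  have "(\<Sum>s\<in>UNIV. \<Sum>t\<in>UNIV. (\<xi> s \<bullet> f - M' t \<bullet> f)\<^sup>2) / 2 \<le> \<Sigma> + 64 * (\<epsilon> * \<epsilon>\<^sup>2)"
    using contact'[of True True] contact'[of True False] contact'[of False True] contact'[of False False]
    unfolding \<Sigma>_def by (simp add: UNIV_bool)
  then show "(\<Sum>s\<in>UNIV. \<Sum>t\<in>UNIV. (\<xi> s \<bullet> f - M' t \<bullet> f)\<^sup>2) / 2 \<le> - ?\<Delta> * ?\<Delta>' + 100 * (\<epsilon> * \<epsilon>\<^sup>2)"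
    using \<Sigma>_le nn by linarith
qed

section \<open>Rigidity of six frames in contact\<close>

text \<open>
  Quantitative form of the sign argument.  Two of three real numbers have the same weak sign, and on
  a 3-cycle any two are consecutive; say they are \<open>u\<close> and its successor.  Then the mixed term of the
  inequality for \<open>u\<close> is nonnegative and \<open>\<bar>u\<bar> \<le> \<eta>\<close>.  Going backwards around the cycle, a bound \<open>K \<eta>\<close>
  on a number gives the bound \<open>(2 K + 1) \<eta>\<close> on its predecessor, whence 1, 3 and 7.
\<close>
lemma alternating_three_cycle:
  fixes x y z \<eta> :: real
  assumes "\<eta> \<ge> 0" "x\<^sup>2 + 2 * x * y \<le> \<eta>\<^sup>2" "y\<^sup>2 + 2 * y * z \<le> \<eta>\<^sup>2" "z\<^sup>2 + 2 * z * x \<le> \<eta>\<^sup>2"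
  shows "\<bar>x\<bar> \<le> 7 * \<eta> \<and> \<bar>y\<bar> \<le> 7 * \<eta> \<and> \<bar>z\<bar> \<le> 7 * \<eta>"
proof -
  have step: "\<bar>u\<bar> \<le> (2 * K + 1) * \<eta>" if "u\<^sup>2 + 2 * u * v \<le> \<eta>\<^sup>2" "\<bar>v\<bar> \<le> K * \<eta>" "K \<ge> 0" for u v K :: real
  proof (rule ccontr)
    assume "\<not> ?thesis"
    then have u: "\<bar>u\<bar> > (2 * K + 1) * \<eta>" by simp
    have K\<eta>: "K * \<eta> \<ge> 0" using that assms(1) by simp
    have "\<bar>u\<bar> * (\<bar>u\<bar> - 2 * \<bar>v\<bar>) > \<eta> * \<eta>"
    proof (rule mult_strict_mono')
      show "\<eta> < \<bar>u\<bar>" using u K\<eta> by (simp add: algebra_simps)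
      show "\<eta> < \<bar>u\<bar> - 2 * \<bar>v\<bar>" using u that K\<eta> by (simp add: algebra_simps)
    qed (use assms u K\<eta> that in \<open>auto simp: algebra_simps\<close>)
    moreover have "- (u * v) \<le> \<bar>u\<bar> * \<bar>v\<bar>" by (metis abs_ge_minus_self abs_mult)
    ultimately show False using that(1)
      by (simp add: power2_eq_square algebra_simps)
  qed
  have core: "\<bar>u\<bar> \<le> 7 * \<eta> \<and> \<bar>v\<bar> \<le> 7 * \<eta> \<and> \<bar>w\<bar> \<le> 7 * \<eta>"
    if "u * v \<ge> 0" "u\<^sup>2 + 2 * u * v \<le> \<eta>\<^sup>2" "v\<^sup>2 + 2 * v * w \<le> \<eta>\<^sup>2" "w\<^sup>2 + 2 * w * u \<le> \<eta>\<^sup>2" for u v w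
  proof -
    have "u\<^sup>2 \<le> \<eta>\<^sup>2" using that(1,2) by simp
    then have u: "\<bar>u\<bar> \<le> 1 * \<eta>" using assms(1) abs_le_square_iff[of u \<eta>] by simp
    from step[OF that(4) this] have w: "\<bar>w\<bar> \<le> 3 * \<eta>" by simp
    from step[OF that(3) this] have v: "\<bar>v\<bar> \<le> 7 * \<eta>" by simp
    show ?thesis using u v w assms(1) by auto
  qed
  consider "x * y \<ge> 0" | "y * z \<ge> 0" | "z * x \<ge> 0"
    by (meson linear mult_nonneg_nonneg mult_nonpos_nonpos)
  then show ?thesis
    using core[of x y z] core[of y z x] core[of z x y] assms by cases auto
qed

lemma numerals_mod_3: "(4::3) = 1" "(5::3) = 2"
  by simp_all

text \<open>
  If all coordinates are at most \<open>\<epsilon> = r\<^sup>2\<close>, the estimates for the three consecutive pairs improve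
  this to a multiple of \<open>r\<^sup>3\<close>, that is, of \<open>\<epsilon>\<^sup>3\<^sup>/\<^sup>2\<close>; writing \<open>\<epsilon>\<close> as a square keeps the
  bounds polynomial.  The sign argument makes the two values of \<open>c\<close> on each pair of lines nearly
  equal, the sums of squares then tie \<open>c\<close> to the values of \<open>a\<close> on the next pair, and
  the first-order relations tie \<open>a\<close> to \<open>b\<close>.  These relations leave exactly the infinitesimal
  rotations free, and those are fixed by the gauge.
\<close>
lemma coordinates_improve:
  fixes a b c :: "3 \<Rightarrow> bool \<Rightarrow> real" and r :: real
  defines "\<Delta> \<equiv> \<lambda>i. c i True - c i False"
  assumes r: "0 \<le> r" "r \<le> 1/10"
    and first: "\<And>i s t. \<bar>a i s + b (i + 1) t\<bar> \<le> 12 * r ^ 4"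
    and second: "\<And>i. (\<Sum>s\<in>UNIV. \<Sum>t\<in>UNIV. (c i s - a (i + 1) t)\<^sup>2) / 2 \<le> - \<Delta> i * \<Delta> (i + 1) + 100 * r ^ 6"
    and gauge: "a 1 True = 0" "b 1 True = 0" "c 1 True = 0"
  shows "\<bar>a i s\<bar> \<le> 400 * r ^ 3 \<and> \<bar>b i s\<bar> \<le> 400 * r ^ 3 \<and> \<bar>c i s\<bar> \<le> 400 * r ^ 3"
proof -
  have cyc: "(1::3) + 1 = 2" "(2::3) + 1 = 3" "(3::3) + 1 = 1" by simp_all
  have r3: "0 \<le> r ^ 3" using r by simp
  have r4: "12 * r ^ 4 \<le> 2 * r ^ 3"
    using mult_right_mono[OF r(2) r3] r3 by (simp add: power_numeral_reduce)
  have r6: "(K * r ^ 3)\<^sup>2 = K\<^sup>2 * r ^ 6" for K by (simp add: power_mult_distrib flip: power_mult)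
  have \<Delta>_ineq: "(\<Delta> i)\<^sup>2 + 2 * \<Delta> i * \<Delta> (i + 1) \<le> (15 * r ^ 3)\<^sup>2" for i
  proof -
    \<comment> \<open>The right side is smallest when \<open>z\<close> is the mean of the two values of \<open>c\<close>.\<close>
    have spread: "(\<Delta> i)\<^sup>2 / 2 \<le> (c i True - z)\<^sup>2 + (c i False - z)\<^sup>2" for z
    proof -
      have "(c i True - z)\<^sup>2 + (c i False - z)\<^sup>2
          = (\<Delta> i)\<^sup>2 / 2 + ((c i True - z) + (c i False - z))\<^sup>2 / 2"
        by (simp add: \<Delta>_def power2_eq_square field_simps)
      then show ?thesis by simp
    qed
    have "(\<Delta> i)\<^sup>2 / 2 \<le> (\<Sum>s\<in>UNIV. \<Sum>t\<in>UNIV. (c i s - a (i + 1) t)\<^sup>2) / 2"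
      using spread[of "a (i + 1) True"] spread[of "a (i + 1) False"] by (simp add: UNIV_bool)
    moreover have "- \<Delta> i * \<Delta> (i + 1) = - (\<Delta> i * \<Delta> (i + 1))" "2 * \<Delta> i * \<Delta> (i + 1) = 2 * (\<Delta> i * \<Delta> (i + 1))"
      "(15 * r ^ 3)\<^sup>2 = 225 * r ^ 6" "0 \<le> r ^ 6"
      using r by (simp_all add: r6)
    ultimately show ?thesis using second[of i] by linarith
  qed
  have "\<bar>\<Delta> 1\<bar> \<le> 7 * (15 * r ^ 3) \<and> \<bar>\<Delta> 2\<bar> \<le> 7 * (15 * r ^ 3) \<and> \<bar>\<Delta> 3\<bar> \<le> 7 * (15 * r ^ 3)"
    using r3 by (intro alternating_three_cycle[OF _ \<Delta>_ineq[of 1, unfolded cyc]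
        \<Delta>_ineq[of 2, unfolded cyc] \<Delta>_ineq[of 3, unfolded cyc]]) simp
  then have \<Delta>: "\<bar>\<Delta> i\<bar> \<le> 105 * r ^ 3" for i
    using exhaust_3[of i] by auto
  have c_near_a: "\<bar>c i s - a (i + 1) t\<bar> \<le> 150 * r ^ 3" for i s t
  proof (rule power2_le_imp_le)
    have "(c i s - a (i + 1) t)\<^sup>2 \<le> (\<Sum>s\<in>UNIV. \<Sum>t\<in>UNIV. (c i s - a (i + 1) t)\<^sup>2)"
      by (cases s; cases t) (simp_all add: UNIV_bool)
    also have "\<dots> \<le> 2 * (105 * r ^ 3 * (105 * r ^ 3) + 100 * r ^ 6)"
      using second[of i] abs_mult_le[OF \<Delta>[of i] \<Delta>[of "i + 1"]] by simp
    also have "\<dots> \<le> (150 * r ^ 3)\<^sup>2"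
      using r6[of 105] r6[of 150] r by (simp add: power2_eq_square)
    finally show "\<bar>c i s - a (i + 1) t\<bar>\<^sup>2 \<le> (150 * r ^ 3)\<^sup>2" by simp
  qed (use r3 in simp)
  note N = first[of 1, unfolded cyc] first[of 2, unfolded cyc] first[of 3, unfolded cyc]
  note C = c_near_a[of 1, unfolded cyc] c_near_a[of 2, unfolded cyc] c_near_a[of 3, unfolded cyc]
  have b2: "\<bar>b 2 t\<bar> \<le> 2 * r ^ 3" for t using N(1)[of True t] gauge r4 by simp
  have a1: "\<bar>a 1 s\<bar> \<le> 4 * r ^ 3" for s using N(1)[of s True] b2[of True] r4 by linarith
  have a3: "\<bar>a 3 s\<bar> \<le> 2 * r ^ 3" for s using N(3)[of s True] gauge r4 by simp
  have b1: "\<bar>b 1 t\<bar> \<le> 4 * r ^ 3" for t using N(3)[of True t] a3[of True] r4 by linarith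
  have a2: "\<bar>a 2 t\<bar> \<le> 150 * r ^ 3" for t using C(1)[of True t] gauge by simp
  have b3: "\<bar>b 3 t\<bar> \<le> 152 * r ^ 3" for t using N(2)[of True t] a2[of True] r4 by linarith
  have c1: "\<bar>c 1 s\<bar> \<le> 300 * r ^ 3" for s using C(1)[of s True] a2[of True] by linarith
  have c2: "\<bar>c 2 s\<bar> \<le> 152 * r ^ 3" for s using C(2)[of s True] a3[of True] by linarith
  have c3: "\<bar>c 3 s\<bar> \<le> 154 * r ^ 3" for s using C(3)[of s True] a1[of True] by linarith
  have le: "\<bar>x\<bar> \<le> 400 * r ^ 3" if "\<bar>x\<bar> \<le> K * r ^ 3" "K \<le> 400" for x K
    using that(1) mult_right_mono[OF that(2) r3] by linarith
  show ?thesis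
    using exhaust_3[of i] le[OF a1[of s]] le[OF a2[of s]] le[OF a3[of s]]
      le[OF b1[of s]] le[OF b2[of s]] le[OF b3[of s]] le[OF c1[of s]] le[OF c2[of s]] le[OF c3[of s]]
    by auto
qed

lemma orthonormal3_cyclic:
  fixes E :: "3 \<Rightarrow> real^3"
  assumes "orthonormal3 (E 1) (E 2) (E 3)"
  shows "orthonormal3 (E i) (E (i + 1)) (E (i + 2))"
proof -
  have "orthonormal3 (E 2) (E 3) (E 1)" "orthonormal3 (E 3) (E 1) (E 2)"
    using assms orthonormal3_rotate by blast+
  moreover have "(1::3) + 1 = 2" "(2::3) + 1 = 3" "(3::3) + 1 = 1" "(1::3) + 2 = 3" "(2::3) + 2 = 1" "(3::3) + 2 = 2"
    by simp_all
  ultimately show ?thesis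
    using assms exhaust_3[of i] by metis
qed

lemma unit_vectors_eqI:
  fixes u v :: "real^3"
  assumes "u \<bullet> u = 1" "v \<bullet> v = 1" "u \<bullet> v = 1"
  shows "u = v"
proof -
  have "(u - v) \<bullet> (u - v) = 0"
    using assms by (simp add: inner_diff_left inner_diff_right inner_commute)
  then show ?thesis by simp
qed

lemma near_frame_0_eq:
  assumes "orthonormal3 e f g" "near_frame 0 e f g X M \<xi>"
  shows "X = e" "\<xi> = g"
proof -
  have "X \<bullet> e = 1" "\<xi> \<bullet> g = 1"
    using near_frame_entries[OF assms] by simp_all
  then show "X = e" "\<xi> = g"
    using assms by (auto simp: orthonormal3_def near_frame_def intro!: unit_vectors_eqI)
qed

text \<open>
  Take for \<open>\<epsilon>\<close> the largest coordinate and \<open>r = sqrt \<epsilon>\<close>.  The improved bound reads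
  \<open>\<epsilon> \<le> 400 r \<epsilon>\<close>, and \<open>r \<le> 1/500\<close> makes the factor less than 1; this is what the
  radius 1/250000 is for.
\<close>
lemma frames_rigid:
  fixes E :: "3 \<Rightarrow> real^3" and X M \<xi> :: "3 \<Rightarrow> bool \<Rightarrow> real^3"
  assumes E: "orthonormal3 (E 1) (E 2) (E 3)"
    and near: "\<And>i s. near_frame (1/250000) (E i) (E (i + 1)) (E (i + 2)) (X i s) (M i s) (\<xi> i s)"
    and contact: "\<And>i s t. sg s * sg t * (M i s \<bullet> \<xi> (i + 1) t) \<ge> (\<xi> i s \<bullet> X (i + 1) t)\<^sup>2 / 2"
    and gauge: "X 1 True = E 1" "M 1 True = E 2" "\<xi> 1 True = E 3"
  shows "X i s = E i \<and> \<xi> i s = E (i + 2)"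
proof -
  define a where "a i s = M i s \<bullet> E i" for i s
  define b where "b i s = \<xi> i s \<bullet> E i" for i s
  define c where "c i s = \<xi> i s \<bullet> E (i + 1)" for i s
  define \<epsilon> where "\<epsilon> = Max (range (\<lambda>(i, s). max \<bar>a i s\<bar> (max \<bar>b i s\<bar> \<bar>c i s\<bar>)))"
  have abc: "\<bar>a i s\<bar> \<le> \<epsilon> \<and> \<bar>b i s\<bar> \<le> \<epsilon> \<and> \<bar>c i s\<bar> \<le> \<epsilon>" for i s
  proof -
    have "max \<bar>a i s\<bar> (max \<bar>b i s\<bar> \<bar>c i s\<bar>) \<le> \<epsilon>"
      unfolding \<epsilon>_def by (rule Max_ge) (auto intro!: range_eqI[of _ _ "(i, s)"])
    then show ?thesis by simp
  qed
  have \<epsilon>_le: "\<epsilon> \<le> K" if "\<And>i s. \<bar>a i s\<bar> \<le> K \<and> \<bar>b i s\<bar> \<le> K \<and> \<bar>c i s\<bar> \<le> K" for K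
    unfolding \<epsilon>_def using that by (subst Max_le_iff) auto
  have "\<epsilon> \<le> 1/250000"
    using near by (intro \<epsilon>_le) (simp add: near_frame_def a_def b_def c_def)
  have \<epsilon>0: "0 \<le> \<epsilon>" using abc[of 1 True] by linarith
  have near_\<epsilon>: "near_frame \<epsilon> (E i) (E (i + 1)) (E (i + 2)) (X i s) (M i s) (\<xi> i s)" for i s
    using near[of i s] abc[of i s] by (simp add: near_frame_def a_def b_def c_def)
  define r where "r = sqrt \<epsilon>"
  have r0: "0 \<le> r" and r2: "r\<^sup>2 = \<epsilon>" using \<epsilon>0 by (simp_all add: r_def)
  have "r\<^sup>2 \<le> (1/500)\<^sup>2" using \<open>\<epsilon> \<le> 1/250000\<close> by (simp add: r2 power_divide)
  then have r_le: "r \<le> 1/500" by (rule power2_le_imp_le) simp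
  have powers: "\<epsilon>\<^sup>2 = r ^ 4" "\<epsilon> * \<epsilon>\<^sup>2 = r ^ 6"
    unfolding r2[symmetric] by (simp_all flip: power_mult power_add)
  have shift: "i + 1 + 1 = i + 2" "i + 1 + 2 = i" for i :: 3
    using exhaust_3[of i] by auto
  have pair: "\<bar>a i s + b (i + 1) t\<bar> \<le> 12 * r ^ 4"
    "(\<Sum>s\<in>UNIV. \<Sum>t\<in>UNIV. (c i s - a (i + 1) t)\<^sup>2) / 2
      \<le> - (c i True - c i False) * (c (i + 1) True - c (i + 1) False) + 100 * r ^ 6" for i s t
    using consecutive_pair_estimates[OF orthonormal3_cyclic[OF E] \<epsilon>0 _ near_\<epsilon>
        near_\<epsilon>[of "i + 1", unfolded shift] contact[of i]] \<open>\<epsilon> \<le> 1/250000\<close>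
    unfolding a_def b_def c_def shift powers(2) unfolding powers(1) by simp_all
  have "\<epsilon> \<le> 400 * r ^ 3"
  proof (rule \<epsilon>_le, rule coordinates_improve)
    show "a 1 True = 0" "b 1 True = 0" "c 1 True = 0"
      using E unfolding a_def b_def c_def gauge by (simp_all add: orthonormal3_def inner_commute)
  qed (use pair r0 r_le in auto)
  also have "\<dots> = 400 * r * \<epsilon>" by (simp add: r2[symmetric] power_numeral_reduce)
  also have "\<dots> \<le> 400 * (1/500) * \<epsilon>" using r_le \<epsilon>0 by (intro mult_right_mono) auto
  finally have "\<epsilon> = 0" using \<epsilon>0 by simp
  then show ?thesis
    using near_frame_0_eq[OF orthonormal3_cyclic[OF E]] near_\<epsilon> by blast
qed

section \<open>The octahedral configuration\<close>

text \<open>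
  The tuples number the lines by natural numbers, while the cyclic symmetry of the configuration
  is addition on the type \<open>3\<close>, where 3 and 0 coincide.
\<close>
definition line_number :: "3 \<Rightarrow> nat" where
  "line_number i = (if i = 1 then 1 else if i = 2 then 2 else 3)"

lemma line_number_simps [simp]: "line_number 1 = 1" "line_number 2 = 2" "line_number 3 = 3"
  by (simp_all add: line_number_def)

lemma line_number_idx: "(line_number i, s) \<in> idx"
  by (simp add: idx_def line_number_def)

lemma idx_cases:
  assumes "k \<in> idx"
  obtains i s where "k = (line_number i, s)"
proof -
  obtain n s where k: "k = (n, s)" by (cases k)
  then have "n = 1 \<or> n = 2 \<or> n = 3" using assms by (auto simp: idx_def)
  then show thesis using that[of 1 s] that[of 2 s] that[of 3 s] k by auto
qed

text \<open>On a 3-cycle any two distinct elements are neighbours, in one order or the other.\<close>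
lemma pairs_are_consecutive:
  assumes "1 \<le> k" "k < l" "l \<le> 3"
  shows "\<exists>i. (k = line_number i \<and> l = line_number (i + 1)) \<or> (l = line_number i \<and> k = line_number (i + 1))"
proof -
  have "(1::3) + 1 = 2" "(2::3) + 1 = 3" "(3::3) + 1 = 1" by simp_all
  moreover have "(k = 1 \<and> l = 2) \<or> (k = 2 \<and> l = 3) \<or> (k = 1 \<and> l = 3)" using assms by auto
  ultimately show ?thesis by (metis line_number_simps)
qed

lemma D_min_le_consecutive: "D_min m \<le> line_dist (m (line_number i, s)) (m (line_number (i + 1), t))"
proof -
  have le: "D_min m \<le> line_dist (m (k, s)) (m (l, t))" if "1 \<le> k" "k < l" "l \<le> 3" for k l s t
    unfolding D_min_def using that by (intro Min_le D_min_finite) blast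
  show ?thesis
    using exhaust_3[of i] le[of 1 2 s t] le[of 2 3 s t] le[of 1 3 t s]
    by (elim disjE) (simp_all add: numerals_mod_3 line_dist_sym)
qed

lemma D_min_eqI:
  assumes "\<And>i s t. line_dist (m (line_number i, s)) (m (line_number (i + 1), t)) = d"
  shows "D_min m = d"
proof -
  have "line_dist (m (k, s)) (m (l, t)) = d" if "1 \<le> k \<and> k < l \<and> l \<le> 3" for k l s t
    using pairs_are_consecutive[of k l] that assms line_dist_sym by metis
  then have "{line_dist (m (k, s)) (m (l, t)) | k l s t. 1 \<le> k \<and> k < l \<and> l \<le> 3} \<subseteq> {d}"
    by auto
  then have "{line_dist (m (k, s)) (m (l, t)) | k l s t. 1 \<le> k \<and> k < l \<and> l \<le> 3} = {d}"
    using D_min_nonempty[of m] by (simp only: subset_singleton_iff) blast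
  then show ?thesis by (simp add: D_min_def)
qed

lemma of_nat_line_number: "(of_nat (line_number i) :: 3) = i"
  using exhaust_3[of i] by auto

definition octahedral_frame :: "3 \<Rightarrow> bool \<Rightarrow> (real^3) \<times> (real^3)" where
  "octahedral_frame i s = (sg s *\<^sub>R axis i 1, axis (i + 2) 1)"

lemma octahedral_frame_unit: "octahedral_frame i s \<in> unit_tangent_bundle"
proof -
  have "i + 2 \<noteq> i" by simp
  then show ?thesis
    by (simp add: octahedral_frame_def unit_tangent_bundle_def inner_axis_axis)
qed

lemma O6_eq: "O6 (line_number i, s) = tline (octahedral_frame i s)"
  using exhaust_3[of i] line_number_idx[of i s]
  by (elim disjE) (simp_all add: O6_def octahedral_frame_def sg_def numerals_mod_3)

text \<open>
  Both lines are orthogonal to \<open>e\<^sub>i\<^sub>+\<^sub>1\<close>, and in that direction they are at distance 1.  The bound is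
  attained because the second line runs in direction \<open>e\<^sub>i\<close> and so passes the point of tangency of
  the first at distance 1.
\<close>
lemma O6_distances: "line_dist (O6 (line_number i, s)) (O6 (line_number (i + 1), t)) = 1"
proof -
  have shift: "i + 1 + 2 = i" using exhaust_3[of i] by auto
  have ne: "i + 1 \<noteq> i" "i + 2 \<noteq> i" "i + 1 \<noteq> i + 2" by simp_all
  let ?x = "sg s *\<^sub>R axis i 1 :: real^3" and ?y = "sg t *\<^sub>R axis (i + 1) 1 :: real^3"
  have utb: "(?x, axis (i + 2) 1) \<in> unit_tangent_bundle" "(?y, axis i 1) \<in> unit_tangent_bundle"
    using octahedral_frame_unit[of i s] octahedral_frame_unit[of "i + 1" t]
    by (simp_all add: octahedral_frame_def shift)
  have "line_dist (tline (?x, axis (i + 2) 1)) (tline (?y, axis i 1)) \<ge> \<bar>axis (i + 1) 1 \<bullet> (?x - ?y)\<bar>"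
    by (rule line_dist_ge[OF utb]) (use ne in \<open>simp_all add: inner_axis_axis\<close>)
  moreover have "\<bar>axis (i + 1) 1 \<bullet> (?x - ?y)\<bar> = 1"
    using ne by (simp add: inner_diff_right inner_axis_axis)
  moreover have "line_dist (tline (?x, axis (i + 2) 1)) (tline (?y, axis i 1)) \<le> 1"
    using line_dist_le[OF utb, of 0 "sg s"] by simp
  ultimately show ?thesis
    by (simp add: O6_eq octahedral_frame_def shift)
qed

lemma D_min_O6: "D_min O6 = 1"
  by (rule D_min_eqI) (rule O6_distances)

section \<open>A neighbourhood of the octahedral configuration\<close>

definition lines_near :: "real \<Rightarrow> nat \<times> bool \<Rightarrow> tline set" where
  "lines_near \<delta> = (\<lambda>(n, s). tline ` (unit_tangent_bundle \<inter> ball (octahedral_frame (of_nat n) s) \<delta>))"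

text \<open>
  The quotient is by the involution \<open>\<xi> \<mapsto> - \<xi>\<close>, a homeomorphism, so the saturation of an open set
  is the union of two open sets.
\<close>
lemma tline_open_image:
  assumes "open S"
  shows "openin tline_topology (tline ` (unit_tangent_bundle \<inter> S))"
proof -
  let ?flip = "\<lambda>p::(real^3)\<times>(real^3). (fst p, - snd p)"
  have "{p \<in> unit_tangent_bundle. tline p \<in> tline ` (unit_tangent_bundle \<inter> S)}
      = unit_tangent_bundle \<inter> (S \<union> ?flip -` S)"
  proof (intro equalityI subsetI)
    fix p assume "p \<in> {p \<in> unit_tangent_bundle. tline p \<in> tline ` (unit_tangent_bundle \<inter> S)}"
    then obtain q where "p \<in> unit_tangent_bundle" "q \<in> S" "tline p = tline q" by blast
    then show "p \<in> unit_tangent_bundle \<inter> (S \<union> ?flip -` S)"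
      by (cases p; cases q) (auto simp: tline_eq_iff)
  next
    fix p assume p: "p \<in> unit_tangent_bundle \<inter> (S \<union> ?flip -` S)"
    then have "?flip p \<in> unit_tangent_bundle" "tline p = tline (?flip p)"
      by (cases p; auto simp: tline_eq_iff unit_tangent_bundle_def)+
    with p show "p \<in> {p \<in> unit_tangent_bundle. tline p \<in> tline ` (unit_tangent_bundle \<inter> S)}"
      by blast
  qed
  moreover have "open (?flip -` S)"
    by (rule open_vimage[OF assms]) (intro continuous_intros)
  ultimately have "openin (top_of_set unit_tangent_bundle)
      {p \<in> unit_tangent_bundle. tline p \<in> tline ` (unit_tangent_bundle \<inter> S)}"
    using assms by (auto simp: openin_open intro!: exI[of _ "S \<union> ?flip -` S"])
  moreover have "tline ` (unit_tangent_bundle \<inter> S) \<subseteq> tangent_lines"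
    unfolding tline_image[symmetric] by auto
  ultimately show ?thesis by (simp add: openin_tline_topology)
qed

lemma openin_lines_near: "openin tuple6_topology (PiE idx (lines_near \<delta>))"
  unfolding tuple6_topology_def
proof (subst openin_PiE)
  show "finite idx" by (simp add: idx_def)
  show "PiE idx (lines_near \<delta>) = {} \<or> (\<forall>k\<in>idx. openin tline_topology (lines_near \<delta> k))"
    by (auto simp: lines_near_def intro!: tline_open_image)
qed

lemma O6_near: "\<delta> > 0 \<Longrightarrow> O6 \<in> PiE idx (lines_near \<delta>)"
proof (rule PiE_I)
  fix k assume "\<delta> > 0" "k \<in> idx"
  then obtain i s where "k = (line_number i, s)" using idx_cases by blast
  then show "O6 k \<in> lines_near \<delta> k"
    using octahedral_frame_unit[of i s] \<open>\<delta> > 0\<close>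
    by (auto simp: lines_near_def O6_eq of_nat_line_number)
qed (simp add: O6_def)

text \<open>
  A line near one of the six has a representative near the standard one, which also fixes the
  sign of its direction vector.  The sign of the line is split off the point of tangency, so that
  both lines with the same number have nearly the same frame.
\<close>
lemma near_O6_lift:
  assumes "m \<in> PiE idx (lines_near \<delta>)"
  obtains X \<xi> where
    "\<And>i s. m (line_number i, s) = tline (sg s *\<^sub>R X i s, \<xi> i s)"
    "\<And>i s. norm (X i s) = 1 \<and> norm (\<xi> i s) = 1 \<and> X i s \<bullet> \<xi> i s = 0"
    "\<And>i s. norm (X i s - axis i 1) \<le> \<delta> \<and> norm (\<xi> i s - axis (i + 2) 1) \<le> \<delta>"
proof -
  have "\<exists>p. p \<in> unit_tangent_bundle \<and> dist (octahedral_frame i s) p < \<delta> \<and> m (line_number i, s) = tline p" for i s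
    using PiE_mem[OF assms line_number_idx[of i s]]
    by (force simp: lines_near_def of_nat_line_number)
  then obtain p where p: "\<And>i s. p i s \<in> unit_tangent_bundle"
    "\<And>i s. dist (octahedral_frame i s) (p i s) < \<delta>" "\<And>i s. m (line_number i, s) = tline (p i s)"
    by metis
  define X where "X i s = sg s *\<^sub>R fst (p i s)" for i s
  define \<xi> where "\<xi> i s = snd (p i s)" for i s
  have p_eq: "p i s = (sg s *\<^sub>R X i s, \<xi> i s)" for i s
    by (simp add: X_def \<xi>_def)
  show thesis
  proof
    fix i s
    show "m (line_number i, s) = tline (sg s *\<^sub>R X i s, \<xi> i s)"
      using p(3)[of i s] by (simp add: p_eq)
    show "norm (X i s) = 1 \<and> norm (\<xi> i s) = 1 \<and> X i s \<bullet> \<xi> i s = 0"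
      using p(1)[of i s] by (cases s) (auto simp: p_eq unit_tangent_bundle_def)
    have "dist (fst (octahedral_frame i s)) (sg s *\<^sub>R X i s) \<le> \<delta>" "dist (snd (octahedral_frame i s)) (\<xi> i s) \<le> \<delta>"
      using p(2)[of i s] dist_fst_le[of "octahedral_frame i s" "p i s"] dist_snd_le[of "octahedral_frame i s" "p i s"]
      by (simp_all add: p_eq)
    then show "norm (X i s - axis i 1) \<le> \<delta> \<and> norm (\<xi> i s - axis (i + 2) 1) \<le> \<delta>"
      by (simp add: octahedral_frame_def dist_norm norm_minus_commute flip: scaleR_diff_right)
  qed
qed

lemma cross3_axis: "cross3 (axis (i + 2) 1) (axis i 1) = (axis (i + 1) 1 :: real^3)"
  using exhaust_3[of i] by (elim disjE) (simp_all add: cross_basis numerals_mod_3)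

section \<open>Sharp local maximality\<close>

lemma inner_close:
  fixes u v u' v' :: "real^3"
  assumes "norm (u - u') \<le> \<alpha>" "norm (v - v') \<le> \<beta>" "norm u = 1" "norm v' = 1"
  shows "\<bar>u \<bullet> v - u' \<bullet> v'\<bar> \<le> \<alpha> + \<beta>"
proof -
  have "u \<bullet> v - u' \<bullet> v' = u \<bullet> (v - v') + (u - u') \<bullet> v'"
    by (simp add: inner_diff_left inner_diff_right)
  moreover have "\<bar>u \<bullet> (v - v')\<bar> \<le> \<beta>" "\<bar>(u - u') \<bullet> v'\<bar> \<le> \<alpha>"
    using Cauchy_Schwarz_ineq2[of u "v - v'"] Cauchy_Schwarz_ineq2[of "u - u'" v'] assms by simp_all
  ultimately show ?thesis by linarith
qed

lemma cross3_close:
  fixes u v u' v' :: "real^3"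
  assumes "norm (u - u') \<le> \<delta>" "norm (v - v') \<le> \<delta>" "norm u = 1" "norm v' = 1"
  shows "norm (cross3 u v - cross3 u' v') \<le> 2 * \<delta>"
proof -
  have cross_le: "norm (cross3 x y) \<le> norm x * norm y" for x y :: "real^3"
  proof (rule power2_le_imp_le)
    show "(norm (cross3 x y))\<^sup>2 \<le> (norm x * norm y)\<^sup>2"
      using norm_cross_dot[of x y] zero_le_power2[of "x \<bullet> y"] by linarith
  qed simp
  have "cross3 u v - cross3 u' v' = cross3 u (v - v') + cross3 (u - u') v'"
    by (simp add: left_diff_distrib right_diff_distrib cross3_simps)
  then have "norm (cross3 u v - cross3 u' v') \<le> norm (cross3 u (v - v')) + norm (cross3 (u - u') v')"
    by (simp add: norm_triangle_ineq)
  also have "\<dots> \<le> 1 * \<delta> + \<delta> * 1"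
    using cross_le[of u "v - v'"] cross_le[of "u - u'" v'] assms by (intro add_mono) simp_all
  finally show ?thesis by simp
qed

lemma rotate_tline:
  assumes "orthogonal_matrix g" "(x, \<xi>) \<in> unit_tangent_bundle"
  shows "rotate_line g (tline (x, \<xi>)) = tline (g *v x, g *v \<xi>)"
proof -
  have o: "orthogonal_transformation (\<lambda>x. g *v x)"
    using assms(1) by (simp add: orthogonal_transformation_matrix)
  have "(g *v x, g *v \<xi>) \<in> unit_tangent_bundle"
    using assms(2) o by (simp add: unit_tangent_bundle_def orthogonal_transformation_norm orthogonal_transformation_def)
  moreover have "g *v (- \<xi>) = - (g *v \<xi>)"
    by (simp add: linear_neg)
  ultimately show ?thesis
    by (simp add: tline_pair assms(2) rotate_line_def)
qed

text \<open>The orientation condition is what makes the matrix a rotation and not a reflection.\<close>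
lemma rotation_onto_frame:
  fixes E :: "3 \<Rightarrow> real^3"
  assumes E: "orthonormal3 (E 1) (E 2) (E 3)" and or: "E 2 = cross3 (E 3) (E 1)"
  obtains g where "rotation_matrix g" "\<And>i. g *v axis i 1 = E i"
proof
  let ?A = "vector [E 1, E 2, E 3] :: real^3^3"
  have "?A ** transpose ?A = mat 1"
    using E by (simp add: vec_eq_iff matrix_matrix_mult_def transpose_def mat_def
        forall_3 sum_3 orthonormal3_def inner_vec_def mult.commute)
  then have "orthogonal_matrix (transpose ?A)"
    by (simp add: orthogonal_matrix)
  moreover have "det ?A = cross3 (E 3) (E 1) \<bullet> E 2"
    by (metis cross_triple dot_cross_det inner_commute)
  then have "det ?A = 1" using E by (simp add: or[symmetric] orthonormal3_def)
  ultimately show "rotation_matrix (transpose ?A)"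
    by (simp add: rotation_matrix_def)
  show "transpose ?A *v axis i 1 = E i" for i
    using exhaust_3[of i]
    by (auto simp: matrix_vector_mul_component vec_eq_iff transpose_def inner_axis matrix_vector_mult_basis column_def)
qed

text \<open>
  The frame of the line \<open>(1, +)\<close> serves as basis \<open>E\<close>, so that the gauge conditions of \<open>frames_rigid\<close>
  hold by definition; the rotation sought is the one that takes the standard basis to \<open>E\<close>.
  The vectors \<open>X\<close> and \<open>\<xi>\<close> are \<open>\<delta>\<close>-close and the products \<open>M\<close> are \<open>2\<delta>\<close>-close to basis vectors, so inner
  products are off by at most \<open>4\<delta>\<close>; hence \<open>\<delta> = 1/1000000\<close> meets the radius of \<open>frames_rigid\<close>.
\<close>
lemma far_near_O6_imp_rotation:
  assumes m: "m \<in> PiE idx (lines_near (1 / 10 ^ 6))" and far: "D_min m \<ge> 1"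
  shows "\<exists>g. rotation_matrix g \<and> m = rotate6 g O6"
proof -
  define \<delta> :: real where "\<delta> = 1 / 10 ^ 6"
  obtain X \<xi> where lift: "\<And>i s. m (line_number i, s) = tline (sg s *\<^sub>R X i s, \<xi> i s)"
    and unit: "\<And>i s. norm (X i s) = 1 \<and> norm (\<xi> i s) = 1 \<and> X i s \<bullet> \<xi> i s = 0"
    and close: "\<And>i s. norm (X i s - axis i 1) \<le> \<delta> \<and> norm (\<xi> i s - axis (i + 2) 1) \<le> \<delta>"
    using near_O6_lift[OF m] unfolding \<delta>_def by metis
  define M where "M i s = cross3 (\<xi> i s) (X i s)" for i s
  have frame: "orthonormal3 (X i s) (M i s) (\<xi> i s)" for i s
    unfolding M_def using unit by (intro orthonormal3_cross) auto
  have unit_M: "norm (M i s) = 1" for i s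
    using frame[of i s] by (simp add: orthonormal3_def norm_eq_1)
  have closeM: "norm (M i s - axis (i + 1) 1) \<le> 2 * \<delta>" for i s
    unfolding M_def cross3_axis[of i, symmetric] using unit close by (intro cross3_close) auto
  define E where "E i = (if i = 1 then X 1 True else if i = 2 then M 1 True else \<xi> 1 True)" for i :: 3
  have E123: "E 1 = X 1 True" "E 2 = M 1 True" "E 3 = \<xi> 1 True"
    by (simp_all add: E_def)
  have E: "orthonormal3 (E 1) (E 2) (E 3)" unfolding E123 by (rule frame)
  have closeE: "norm (E i - axis i 1) \<le> 2 * \<delta>" for i
  proof -
    have "(1::3) + 1 = 2" "(1::3) + 2 = 3" by simp_all
    then show ?thesis
      using exhaust_3[of i] close[of 1 True] closeM[of 1 True] E123 by (auto simp: \<delta>_def)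
  qed
  have ne: "i + 1 \<noteq> i" "i \<noteq> i + 1" "i + 2 \<noteq> i" "i + 2 \<noteq> i + 1" for i :: 3 by simp_all
  have shift: "i + 1 + 1 = i + 2" "i + 1 + 2 = i" for i :: 3
    using exhaust_3[of i] by auto
  have near: "near_frame (1/250000) (E i) (E (i + 1)) (E (i + 2)) (X i s) (M i s) (\<xi> i s)" for i s
  proof -
    note cX = inner_close[OF conjunct1[OF close[of i s]] closeE]
      and cM = inner_close[OF closeM[of i s] closeE]
      and c\<xi> = inner_close[OF conjunct2[OF close[of i s]] closeE]
    have "\<bar>X i s \<bullet> E i - 1\<bar> \<le> 4 * \<delta>" "\<bar>M i s \<bullet> E (i + 1) - 1\<bar> \<le> 4 * \<delta>" "\<bar>\<xi> i s \<bullet> E (i + 2) - 1\<bar> \<le> 4 * \<delta>"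
      "\<bar>M i s \<bullet> E i\<bar> \<le> 4 * \<delta>" "\<bar>\<xi> i s \<bullet> E i\<bar> \<le> 4 * \<delta>" "\<bar>\<xi> i s \<bullet> E (i + 1)\<bar> \<le> 4 * \<delta>"
      using cX[of i] cM[of "i + 1"] c\<xi>[of "i + 2"] cM[of i] c\<xi>[of i] c\<xi>[of "i + 1"] unit[of i s] unit_M[of i s]
      by (simp_all add: inner_axis_axis ne \<delta>_def)
    moreover have "y > 0" if "\<bar>y - 1\<bar> \<le> 4 * \<delta>" for y
    proof -
      have "4 * \<delta> < 1" by (simp add: \<delta>_def)
      with that show ?thesis by linarith
    qed
    ultimately show ?thesis
      unfolding near_frame_def using frame[of i s] by (auto simp: \<delta>_def)
  qed
  have contact: "sg s * sg t * (M i s \<bullet> \<xi> (i + 1) t) \<ge> (\<xi> i s \<bullet> X (i + 1) t)\<^sup>2 / 2" for i s t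
    unfolding M_def
  proof (rule contact_inequality)
    show "orthonormal3 (X i s) (cross3 (\<xi> i s) (X i s)) (\<xi> i s)"
      "orthonormal3 (X (i + 1) t) (cross3 (\<xi> (i + 1) t) (X (i + 1) t)) (\<xi> (i + 1) t)"
      using frame[of i s] frame[of "i + 1" t] by (simp_all add: M_def)
    show "1 \<le> line_dist (tline (sg s *\<^sub>R X i s, \<xi> i s)) (tline (sg t *\<^sub>R X (i + 1) t, \<xi> (i + 1) t))"
      using far D_min_le_consecutive[of m i s t] by (simp add: lift)
    have "\<bar>\<xi> i s \<bullet> M (i + 1) t - axis (i + 2) 1 \<bullet> (axis (i + 2) 1 :: real^3)\<bar> \<le> \<delta> + 2 * \<delta>"
      using close[of i s] closeM[of "i + 1" t] unit[of i s] unfolding shift by (intro inner_close) auto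
    moreover have "\<bar>M i s \<bullet> \<xi> (i + 1) t - axis (i + 1) 1 \<bullet> (axis i 1 :: real^3)\<bar> \<le> 2 * \<delta> + \<delta>"
      using close[of "i + 1" t] closeM[of i s] unit_M[of i s] unfolding shift by (intro inner_close) auto
    moreover have "0 \<le> p + sg s * sg t * \<mu>" if "\<bar>p - 1\<bar> \<le> \<delta> + 2 * \<delta>" "\<bar>\<mu> - 0\<bar> \<le> 2 * \<delta> + \<delta>" for p \<mu>
    proof -
      have "\<bar>sg s * sg t * \<mu>\<bar> = \<bar>\<mu>\<bar>" by (simp add: abs_mult)
      moreover have "6 * \<delta> \<le> 1" by (simp add: \<delta>_def)
      ultimately show ?thesis using that by linarith
    qed
    ultimately show "0 \<le> \<xi> i s \<bullet> cross3 (\<xi> (i + 1) t) (X (i + 1) t)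
        + sg s * sg t * (cross3 (\<xi> i s) (X i s) \<bullet> \<xi> (i + 1) t)"
      unfolding M_def[symmetric] by (simp add: inner_axis_axis ne)
  qed
  have rigid: "X i s = E i" "\<xi> i s = E (i + 2)" for i s
    using frames_rigid[OF E near contact, of i s] E123 by simp_all
  obtain g where g: "rotation_matrix g" "\<And>i. g *v axis i 1 = E i"
    using rotation_onto_frame[OF E] unfolding E123 M_def by metis
  have "m = rotate6 g O6"
  proof (rule extensionalityI)
    show "m \<in> extensional idx" using m by (auto simp: PiE_def)
    show "rotate6 g O6 \<in> extensional idx" by (simp add: rotate6_def)
    fix k assume "k \<in> idx"
    then obtain i s where k: "k = (line_number i, s)" using idx_cases by blast
    have "rotate_line g (O6 k) = tline (g *v (sg s *\<^sub>R axis i 1), g *v axis (i + 2) 1)"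
      using rotate_tline octahedral_frame_unit[of i s] g(1)
      by (simp add: k O6_eq octahedral_frame_def rotation_matrix_def)
    also have "\<dots> = m k"
      by (simp add: k lift rigid g(2) matrix_vector_mult_scaleR)
    finally show "m k = rotate6 g O6 k" using \<open>k \<in> idx\<close> by (simp add: rotate6_def)
  qed
  with g(1) show ?thesis by blast
qed

theorem theorem1:
  shows "D_min O6 = 1 \<and>
    (\<exists>W. openin tuple6_topology W \<and> O6 \<in> W \<and>
      (\<forall>m\<in>W. (\<nexists>g. rotation_matrix g \<and> m = rotate6 g O6) \<longrightarrow> D_min m < 1))"
proof (intro conjI exI ballI impI)
  let ?W = "PiE idx (lines_near (1 / 10 ^ 6))"
  show "D_min O6 = 1" by (rule D_min_O6)
  show "openin tuple6_topology ?W" by (rule openin_lines_near)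
  show "O6 \<in> ?W" by (rule O6_near) simp
  show "D_min m < 1" if "m \<in> ?W" "\<nexists>g. rotation_matrix g \<and> m = rotate6 g O6" for m
    using far_near_O6_imp_rotation[OF that(1)] that(2) by (meson not_le)
qed

end
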